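(* Assume the standing assumptions (i)--(iii), the bounded-iterates assumption, and $M\ge L_2$ (all in the context). Fix $p\ge 3$, $c_{\mathrm{mix}}\ge 0$, and run DisGrem with the logarithmic schedule $$\tau_k=t_k=\Bigl\lceil \frac{p\log(k+2)+c_{\mathrm{mix}}}{-\log\rho}\Bigr\rceil,\qquad k\ge 0 .$$ For $0<\varepsilon\le1$ let $K(\varepsilon)$ be the first $k\ge0$ with $\|\nabla f(\bar x_k)\|\le\varepsilon$, and let $K_0(\varepsilon)$ be the burn-in index for $\varepsilon$ (as in the context). Then the total number of communication rounds satisfies $$\sum_{k=0}^{K(\varepsilon)-1}(\tau_k+2t_k)=\mathcal O\Bigl((1-\rho)^{-1}\bigl(K_0(\varepsilon)+\varepsilon^{-1}\bigr)\log\bigl(K_0(\varepsilon)+\varepsilon^{-1}\bigr)\Bigr).$$ In particular, since $p\ge3$, $$\sum_{k=0}^{K(\varepsilon)-1}(\tau_k+2t_k)=\mathcal O\bigl((1-\rho)^{-1}\varepsilon^{-1}\log(1/\varepsilon)\bigr),$$ which for a fixed connected network reduces to $\mathcal O(\varepsilon^{-1}\log(1/\varepsilon))$.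
   Context: Norms: $\|\cdot\|$ is the Euclidean norm for (stacked) vectors; $\|\cdot\|_2$ is the spectral norm for matrices. Problem and standing assumptions. $f=\frac1N\sum_{i=1}^N f_i$ with $f_i:\mathbb R^d\to\mathbb R$. (i) Each $f_i$ is convex, twice continuously differentiable, with $\|\nabla f_i(x)-\nabla f_i(y)\|\le L_1\|x-y\|$ and $\|\nabla^2 f_i(x)-\nabla^2 f_i(y)\|_2\le L_2\|x-y\|$ for all $x,y$. (ii) $W\in\mathbb R^{N\times N}$ is entrywise nonnegative, symmetric, doubly stochastic, with positive diagonal (its off-diagonal support is contained in the edge set of a connected undirected graph), and $\rho:=\|W-\frac1N\mathbf 1\mathbf 1^\top\|_2<1$. (iii) $f$ is coercive. The logarithmic schedule presupposes $\rho\in(0,1)$. Algorithm DisGrem. Inputs: $x_{i,0}\in\mathbb R^d$ ($i=1,\dots,N$), $M>0$, integers $\tau_k,t_k\ge1$. Initialize $g_{i,0}=\nabla f_i(x_{i,0})$, $H_{i,0}=\nabla^2 f_i(x_{i,0})$. For $k\ge 0$: (A) $\tilde x_{i,k}=\sum_j[W^{\tau_k}]_{ij}x_{j,k}$, $\tilde g_{i,k}=\sum_j[W^{\tau_k}]_{ij}g_{j,k}$, $\tilde H_{i,k}=\sum_j[W^{\tau_k}]_{ij}H_{j,k}$. (B) $\lambda_{i,k}=\sqrt{M\|\tilde g_{i,k}\|}$, $\delta_{i,k}=\max\{0,-\lambda_{\min}(\tilde H_{i,k})\}$; if $\tilde g_{i,k}=0$ then $s_{i,k}=0$, otherwise $s_{i,k}$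 solves $(\tilde H_{i,k}+(\lambda_{i,k}+\delta_{i,k})I)s_{i,k}=-\tilde g_{i,k}$. (C) $x_{i,k+1}=\sum_j[W^{t_k}]_{ij}(\tilde x_{j,k}+s_{j,k})$. (D) $g_{i,k+1}=\sum_j[W^{t_k}]_{ij}(\tilde g_{j,k}+\nabla f_j(x_{j,k+1})-\nabla f_j(x_{j,k}))$ and $H_{i,k+1}=\sum_j[W^{t_k}]_{ij}(\tilde H_{j,k}+\nabla^2 f_j(x_{j,k+1})-\nabla^2 f_j(x_{j,k}))$. Iteration $k$ uses $\tau_k+2t_k$ neighbor communication rounds. Bounded-iterates assumption. There are $x_\star\in\arg\min f$ and a finite $D>0$ such that $\|\bar x_k-x_\star\|\le D$, $\|x_{i,k}-x_\star\|\le D$, $\|\tilde x_{i,k}-x_\star\|\le D$ for all $k\ge0$ and all $i$. Notation. $\bar x_k=\frac1N\sum_i x_{i,k}$, $\bar s_k=\frac1N\sum_i s_{i,k}$, $\tilde{\bar g}_k=\frac1N\sum_i\tilde g_{i,k}$, $\tilde{\bar H}_k=\frac1N\sum_i\tilde H_{i,k}$, $\bar\delta_k=\frac1N\sum_i\delta_{i,k}$, $\lambda_k=\frac1N\sum_i(\lambda_{i,k}+\delta_{i,k})$, $g_k=\nabla f(\bar x_k)$, $M_{H,\max}=L_1$. $D(X_k)=\bigl(\frac1N\sum_i\|x_{i,k}-\bar x_k\|^2\bigr)^{1/2}$ (not to be confused with the constant $D$). $\Delta_k^g=\frac1N\sum_i\|\tilde g_{i,k}-\tilde{\bar g}_k\|$,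 $\Delta_k^H=\frac1N\sum_i\|\tilde H_{i,k}-\tilde{\bar H}_k\|_2$. When $A_k^{\mathrm{ref}}:=\tilde{\bar H}_k+\lambda_kI$ is nonsingular, $s_k^{\mathrm{ref}}:=-(A_k^{\mathrm{ref}})^{-1}\tilde{\bar g}_k$. Burn-in index for $\varepsilon$. The smallest integer $K_0\ge 0$ such that, with $\eta=1/12$: for every $k\ge K_0$ with $\|g_k\|\ge\varepsilon$, $A_k^{\mathrm{ref}}$ is nonsingular and (1) $\|\bar s_k-s_k^{\mathrm{ref}}\|\le\frac{\eta}{8}\frac{\lambda_k}{M_{H,\max}+\lambda_k}\|\bar s_k\|$, (2) $L_1D(X_k)\le\frac{\eta}{8}\lambda_k\|\bar s_k\|$, (3) $L_2D(X_k)\le\frac{\eta}{8}\lambda_k$; and for every $k\ge K_0$: $\Delta_k^g\le\varepsilon^2$, $\Delta_k^H\le\varepsilon^{3/2}$, $D(X_k)\le\varepsilon^{3/2}$, $\bar\delta_k\le(1+L_2)\varepsilon^{3/2}$. $\mathcal O$-convention. $\mathcal O(\cdot)$ is as $\varepsilon\downarrow0$, with hidden constants independent of $\varepsilon$; they may depend on $d,N,L_1,L_2,D,M,p,c_{\mathrm{mix}}$, the initial data and the spectral gap. The displayed factor $(1-\rho)^{-1}$ records the dependence on $\rho$ coming from the per-iteration mixing depth, $-1/\log\rho=\Theta((1-\rho)^{-1})$ as $\rho\to1$. *)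

theory Defs
  imports "HOL-Analysis.Analysis" "HOL-Library.Landau_Symbols"
begin

definition gradient :: "(real^'d \<Rightarrow> real) \<Rightarrow> real^'d \<Rightarrow> real^'d" where
  "gradient \<phi> x = (THE v. GDERIV \<phi> x :> v)"

definition hessian :: "(real^'d \<Rightarrow> real) \<Rightarrow> real^'d \<Rightarrow> real^'d^'d" where
  "hessian \<phi> x = jacobian (gradient \<phi>) (at x)"

definition twice_cont_diff :: "(real^'d \<Rightarrow> real) \<Rightarrow> bool" where
  "twice_cont_diff \<phi> \<longleftrightarrow>
     (\<forall>x. \<phi> differentiable (at x)) \<and>
     (\<forall>x. gradient \<phi> differentiable (at x)) \<and>
     continuous_on UNIV (hessian \<phi>)"

text \<open>The type-class norm on matrices is the Frobenius norm; the spectral norm is the operator norm.\<close>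

definition spectral_norm :: "real^'b^'a \<Rightarrow> real" where
  "spectral_norm A = onorm ((*v) A)"

text \<open>Only meaningful if \<open>A\<close> has a real eigenvalue; it is applied to symmetric matrices.\<close>

definition min_eigenvalue :: "real^'d^'d \<Rightarrow> real" where
  "min_eigenvalue A = (LEAST \<mu>. \<exists>v. v \<noteq> 0 \<and> A *v v = \<mu> *\<^sub>R v)"

text \<open>The type-class power on \<open>real^'n^'n\<close> is entrywise, hence the explicit iterate.\<close>

definition matrix_power :: "real^'n^'n \<Rightarrow> nat \<Rightarrow> real^'n^'n" where
  "matrix_power A m = ((**) A ^^ m) (mat 1)"

definition avg :: "('n::finite \<Rightarrow> 'v::real_vector) \<Rightarrow> 'v" where
  "avg v = (\<Sum>i\<in>UNIV. v i) /\<^sub>R real CARD('n)"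

definition objective :: "('n::finite \<Rightarrow> real^'d \<Rightarrow> real) \<Rightarrow> real^'d \<Rightarrow> real" where
  "objective f x = avg (\<lambda>i. f i x)"

definition smooth_convex :: "('n::finite \<Rightarrow> real^'d \<Rightarrow> real) \<Rightarrow> real \<Rightarrow> real \<Rightarrow> bool" where
  "smooth_convex f L1 L2 \<longleftrightarrow>
     (\<forall>i. convex_on UNIV (f i) \<and> twice_cont_diff (f i) \<and>
       (\<forall>x y. norm (gradient (f i) x - gradient (f i) y) \<le> L1 * norm (x - y)) \<and>
       (\<forall>x y. spectral_norm (hessian (f i) x - hessian (f i) y) \<le> L2 * norm (x - y)))"

definition coercive :: "(real^'d \<Rightarrow> real) \<Rightarrow> bool" where
  "coercive \<phi> \<longleftrightarrow> filterlim \<phi> at_top at_infinity"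

definition connected_graph :: "('n \<times> 'n) set \<Rightarrow> bool" where
  "connected_graph E \<longleftrightarrow> sym E \<and> irrefl E \<and> E\<^sup>* = UNIV"

definition contraction_factor :: "real^'n^'n \<Rightarrow> real" where
  "contraction_factor W = spectral_norm (W - (\<chi> i j. 1 / real CARD('n)))"

definition mixing_matrix :: "real^'n^'n \<Rightarrow> bool" where
  "mixing_matrix W \<longleftrightarrow>
     (\<forall>i j. 0 \<le> W $ i $ j) \<and>
     transpose W = W \<and>
     (\<forall>i. (\<Sum>j\<in>UNIV. W $ i $ j) = 1) \<and> (\<forall>j. (\<Sum>i\<in>UNIV. W $ i $ j) = 1) \<and>
     (\<forall>i. 0 < W $ i $ i) \<and>
     (\<exists>E. connected_graph E \<and> (\<forall>i j. i \<noteq> j \<longrightarrow> W $ i $ j \<noteq> 0 \<longrightarrow> (i, j) \<in> E)) \<and>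
     contraction_factor W < 1"

text \<open>
  The sequences generated by the method, indexed by iteration and agent. The fields \<open>tld_x\<close>,
  \<open>tld_g\<close>, \<open>tld_H\<close> hold the quantities written with a tilde.
\<close>

record ('n, 'd) run =
  run_x :: "nat \<Rightarrow> 'n \<Rightarrow> real^'d"
  run_g :: "nat \<Rightarrow> 'n \<Rightarrow> real^'d"
  run_H :: "nat \<Rightarrow> 'n \<Rightarrow> real^'d^'d"
  tld_x :: "nat \<Rightarrow> 'n \<Rightarrow> real^'d"
  tld_g :: "nat \<Rightarrow> 'n \<Rightarrow> real^'d"
  tld_H :: "nat \<Rightarrow> 'n \<Rightarrow> real^'d^'d"
  run_s :: "nat \<Rightarrow> 'n \<Rightarrow> real^'d"

definition mix :: "real^'n^'n \<Rightarrow> nat \<Rightarrow> ('n \<Rightarrow> 'v::real_vector) \<Rightarrow> 'n \<Rightarrow> 'v" where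
  "mix W m v i = (\<Sum>j\<in>UNIV. (matrix_power W m $ i $ j) *\<^sub>R v j)"

definition lam :: "real \<Rightarrow> ('n, 'd::finite) run \<Rightarrow> nat \<Rightarrow> 'n \<Rightarrow> real" where
  "lam M r k i = sqrt (M * norm (tld_g r k i))"

definition del :: "('n, 'd::finite) run \<Rightarrow> nat \<Rightarrow> 'n \<Rightarrow> real" where
  "del r k i = max 0 (- min_eigenvalue (tld_H r k i))"

definition disgrem ::
  "('n::finite \<Rightarrow> real^'d \<Rightarrow> real) \<Rightarrow> real^'n^'n \<Rightarrow> real \<Rightarrow> (nat \<Rightarrow> nat) \<Rightarrow> (nat \<Rightarrow> nat) \<Rightarrow>
     ('n, 'd) run \<Rightarrow> bool" where
  "disgrem f W M \<tau> t r \<longleftrightarrow>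
     (\<forall>i. run_g r 0 i = gradient (f i) (run_x r 0 i)) \<and>
     (\<forall>i. run_H r 0 i = hessian (f i) (run_x r 0 i)) \<and>
     (\<forall>k i.
       tld_x r k i = mix W (\<tau> k) (run_x r k) i \<and>
       tld_g r k i = mix W (\<tau> k) (run_g r k) i \<and>
       tld_H r k i = mix W (\<tau> k) (run_H r k) i \<and>
       (if tld_g r k i = 0 then run_s r k i = 0
        else (tld_H r k i + (lam M r k i + del r k i) *\<^sub>R mat 1) *v run_s r k i
               = - tld_g r k i) \<and>
       run_x r (Suc k) i = mix W (t k) (\<lambda>j. tld_x r k j + run_s r k j) i \<and>
       run_g r (Suc k) i = mix W (t k)
         (\<lambda>j. tld_g r k j + gradient (f j) (run_x r (Suc k) j) - gradient (f j) (run_x r k j)) i \<and>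
       run_H r (Suc k) i = mix W (t k)
         (\<lambda>j. tld_H r k j + hessian (f j) (run_x r (Suc k) j) - hessian (f j) (run_x r k j)) i)"

definition log_schedule :: "real \<Rightarrow> real \<Rightarrow> real \<Rightarrow> nat \<Rightarrow> nat" where
  "log_schedule p c_mix \<rho> k = nat \<lceil>(p * ln (real k + 2) + c_mix) / (- ln \<rho>)\<rceil>"

definition comm_rounds :: "(nat \<Rightarrow> nat) \<Rightarrow> (nat \<Rightarrow> nat) \<Rightarrow> nat \<Rightarrow> nat" where
  "comm_rounds \<tau> t K = (\<Sum>k<K. \<tau> k + 2 * t k)"

definition xbar :: "('n::finite, 'd::finite) run \<Rightarrow> nat \<Rightarrow> real^'d" where
  "xbar r k = avg (run_x r k)"

definition bounded_iterates ::
  "('n::finite \<Rightarrow> real^'d \<Rightarrow> real) \<Rightarrow> real \<Rightarrow> ('n, 'd) run \<Rightarrow> bool" where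
  "bounded_iterates f D r \<longleftrightarrow>
     (\<exists>x_star. is_arg_min (objective f) (\<lambda>_. True) x_star \<and>
       (\<forall>k. norm (xbar r k - x_star) \<le> D \<and>
         (\<forall>i. norm (run_x r k i - x_star) \<le> D \<and> norm (tld_x r k i - x_star) \<le> D)))"

definition sbar :: "('n::finite, 'd::finite) run \<Rightarrow> nat \<Rightarrow> real^'d" where
  "sbar r k = avg (run_s r k)"

definition gbar :: "('n::finite, 'd::finite) run \<Rightarrow> nat \<Rightarrow> real^'d" where
  "gbar r k = avg (tld_g r k)"

definition Hbar :: "('n::finite, 'd::finite) run \<Rightarrow> nat \<Rightarrow> real^'d^'d" where
  "Hbar r k = avg (tld_H r k)"

definition delbar :: "('n::finite, 'd::finite) run \<Rightarrow> nat \<Rightarrow> real" where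
  "delbar r k = avg (del r k)"

definition lambar :: "real \<Rightarrow> ('n::finite, 'd::finite) run \<Rightarrow> nat \<Rightarrow> real" where
  "lambar M r k = avg (\<lambda>i. lam M r k i + del r k i)"

definition dispersion :: "('n::finite, 'd::finite) run \<Rightarrow> nat \<Rightarrow> real" where
  "dispersion r k = sqrt (avg (\<lambda>i. (norm (run_x r k i - xbar r k))\<^sup>2))"

definition Delta_g :: "('n::finite, 'd::finite) run \<Rightarrow> nat \<Rightarrow> real" where
  "Delta_g r k = avg (\<lambda>i. norm (tld_g r k i - gbar r k))"

definition Delta_H :: "('n::finite, 'd::finite) run \<Rightarrow> nat \<Rightarrow> real" where
  "Delta_H r k = avg (\<lambda>i. spectral_norm (tld_H r k i - Hbar r k))"

definition A_ref :: "real \<Rightarrow> ('n::finite, 'd::finite) run \<Rightarrow> nat \<Rightarrow> real^'d^'d" where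
  "A_ref M r k = Hbar r k + lambar M r k *\<^sub>R mat 1"

definition s_ref :: "real \<Rightarrow> ('n::finite, 'd::finite) run \<Rightarrow> nat \<Rightarrow> real^'d" where
  "s_ref M r k = - (matrix_inv (A_ref M r k) *v gbar r k)"

definition grad_norm ::
  "('n::finite \<Rightarrow> real^'d \<Rightarrow> real) \<Rightarrow> ('n, 'd) run \<Rightarrow> nat \<Rightarrow> real" where
  "grad_norm f r k = norm (gradient (objective f) (xbar r k))"

definition first_hit ::
  "('n::finite \<Rightarrow> real^'d \<Rightarrow> real) \<Rightarrow> ('n, 'd) run \<Rightarrow> real \<Rightarrow> nat" where
  "first_hit f r \<epsilon> = (LEAST k. grad_norm f r k \<le> \<epsilon>)"

text \<open>Here \<open>\<eta> = 1/12\<close>, and \<open>L1\<close> next to \<open>lambar\<close> is the uniform bound on the Hessian norms.\<close>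

definition burned_in ::
  "('n::finite \<Rightarrow> real^'d \<Rightarrow> real) \<Rightarrow> real \<Rightarrow> real \<Rightarrow> real \<Rightarrow> ('n, 'd) run \<Rightarrow> real \<Rightarrow> nat \<Rightarrow> bool" where
  "burned_in f L1 L2 M r \<epsilon> K \<longleftrightarrow> (let \<eta> = 1 / 12 in
     (\<forall>k\<ge>K. grad_norm f r k \<ge> \<epsilon> \<longrightarrow>
        invertible (A_ref M r k) \<and>
        norm (sbar r k - s_ref M r k)
          \<le> \<eta> / 8 * (lambar M r k / (L1 + lambar M r k)) * norm (sbar r k) \<and>
        L1 * dispersion r k \<le> \<eta> / 8 * lambar M r k * norm (sbar r k) \<and>
        L2 * dispersion r k \<le> \<eta> / 8 * lambar M r k) \<and>
     (\<forall>k\<ge>K.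
        Delta_g r k \<le> \<epsilon>\<^sup>2 \<and>
        Delta_H r k \<le> \<epsilon> powr (3/2) \<and>
        dispersion r k \<le> \<epsilon> powr (3/2) \<and>
        delbar r k \<le> (1 + L2) * \<epsilon> powr (3/2)))"

definition burn_in_index ::
  "('n::finite \<Rightarrow> real^'d \<Rightarrow> real) \<Rightarrow> real \<Rightarrow> real \<Rightarrow> real \<Rightarrow> ('n, 'd) run \<Rightarrow> real \<Rightarrow> nat" where
  "burn_in_index f L1 L2 M r \<epsilon> = (LEAST K. burned_in f L1 L2 M r \<epsilon> K)"

definition log_rounds :: "real \<Rightarrow> real \<Rightarrow> real \<Rightarrow> nat \<Rightarrow> real" where
  "log_rounds p c_mix \<rho> K =
     real (comm_rounds (log_schedule p c_mix \<rho>) (log_schedule p c_mix \<rho>) K)"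

text \<open>
  All problems, networks and runs that share the quantities on which hidden constants may depend:
  \<open>d\<close> and \<open>N\<close> (through the types), \<open>L1\<close>, \<open>L2\<close>, \<open>D\<close>, \<open>M\<close>, \<open>p\<close>, \<open>c_mix\<close>, the spectral gap
  \<open>1 - \<rho>\<close>, and the initial data \<open>x0\<close>, \<open>g0\<close>, \<open>H0\<close>. For a set \<open>S\<close> of this form, membership in
  \<open>O[principal S \<times>\<^sub>F at_right 0](_)\<close> is a bound as \<open>\<epsilon> \<down> 0\<close> whose constant and threshold are the
  same for every element of \<open>S\<close>.
\<close>

definition instances ::
  "real \<Rightarrow> real \<Rightarrow> real \<Rightarrow> real \<Rightarrow> real \<Rightarrow> real \<Rightarrow> real \<Rightarrow>
     ('n \<Rightarrow> real^'d) \<Rightarrow> ('n \<Rightarrow> real^'d) \<Rightarrow> ('n \<Rightarrow> real^'d^'d) \<Rightarrow>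
     (('n::finite \<Rightarrow> real^'d \<Rightarrow> real) \<times> (real^'n^'n) \<times> ('n, 'd) run) set" where
  "instances L1 L2 D M p c_mix \<rho> x0 g0 H0 =
     {(f, W, r).
        smooth_convex f L1 L2 \<and> coercive (objective f) \<and>
        mixing_matrix W \<and> contraction_factor W = \<rho> \<and>
        disgrem f W M (log_schedule p c_mix \<rho>) (log_schedule p c_mix \<rho>) r \<and>
        bounded_iterates f D r \<and>
        run_x r 0 = x0 \<and> run_g r 0 = g0 \<and> run_H r 0 = H0}"

end

theory Submission
  imports Defs "HOL-Real_Asymp.Real_Asymp"
begin

text \<open>
  The proof bounds the hitting time by \<open>C / \<epsilon>\<close>, with \<open>C\<close> depending only on the parameters shared
  by all instances. Since \<open>1 / \<epsilon> \<le> K0 + 1 / \<epsilon>\<close>, this one bound gives all three estimates: each of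
  the first \<open>C / \<epsilon>\<close> iterations costs \<open>O(log (1 / \<epsilon>))\<close> rounds.

  The schedule makes the mixing factor \<open>\<rho> ^ t k\<close> at most \<open>1 / (k + 2)\<^sup>2\<close>, while the quantities that
  are mixed stay bounded because the iterates do. Hence the local gradients, Hessians and points agree
  with their values at the mean iterate \<open>x\<close> up to \<open>O(1 / (k + 1)\<^sup>2)\<close> (\<open>tld_g_err\<close>, \<open>tld_H_err\<close>,
  \<open>dist_xbar\<close>). The same holds for the shifts \<open>\<delta>\<close>, because the Hessian at the mean is positive
  semidefinite and a least eigenvalue is a minimum of a Rayleigh quotient (\<open>del_le\<close>).

  The mean iterate moves by the average of the local steps, so by Jensen's inequality it suffices that
  each single step \<open>s\<close> decreases the objective \<open>F\<close> (\<open>agent_descent\<close>). With \<open>B\<close> the shifted local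
  matrix and \<open>g\<close> the local gradient, \<open>B s = - g\<close>; a Taylor estimate leaves
  \<open>F (x + s) \<le> F x - s \<bullet> B s / 2 - (\<lambda> - L2 |s|) |s|\<^sup>2 / 2\<close> up to tracking errors. The choice
  \<open>\<lambda>\<^sup>2 = M |g|\<close> forces \<open>M |s| \<le> \<lambda>\<close>, so the last term has the right sign as \<open>L2 \<le> M\<close>, and
  \<open>s \<bullet> B s \<ge> |g|\<^sup>2 / |B|\<close> because \<open>B\<close> is symmetric and positive semidefinite. From \<open>k \<ge> const / \<epsilon>\<close> on,
  the errors are negligible against \<open>\<epsilon>\<^sup>2\<close>, which gives the descent of a gradient method (\<open>descent\<close>).
  With the gap bound \<open>F x - min F \<le> D |grad F x|\<close> this yields \<open>O(1 / \<epsilon>)\<close> further iterations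
  (\<open>sublinear_rate\<close>, \<open>hit\<close>).

  A burn-in index exists because every quantity required to be small decays, while as long as
  \<open>|grad F x| \<ge> \<epsilon>\<close> the regularisation and the mean step stay away from \<open>0\<close> (\<open>burned_in_exists\<close>).
\<close>

section \<open>Symmetric matrices\<close>

lemma symmetric_matrix_inner:
  fixes A :: "real^'d^'d"
  assumes "transpose A = A"
  shows "x \<bullet> (A *v y) = y \<bullet> (A *v x)"
  by (metis assms dot_lmul_matrix inner_commute vector_transpose_matrix)

lemma symmetric_matrixI:
  fixes A :: "real^'d^'d"
  assumes "\<And>x y. x \<bullet> (A *v y) = y \<bullet> (A *v x)"
  shows "transpose A = A"
proof -
  have "A $ i $ j = A $ j $ i" for i j
    using assms[of "axis i 1" "axis j 1"]
    by (simp add: inner_axis' matrix_vector_mul_component inner_axis)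
  then show ?thesis
    by (simp add: vec_eq_iff transpose_def)
qed

lemma norm_matrix_vector_le:
  fixes A :: "real^'b^'a"
  shows "norm (A *v x) \<le> norm A * norm x"
proof -
  have "norm (A *v x) \<le> L2_set (\<lambda>i. norm (A $ i) * norm x) UNIV"
    unfolding norm_vec_def[of "A *v x"]
    by (rule L2_set_mono) (simp_all add: matrix_vector_mul_component Cauchy_Schwarz_ineq2)
  also have "\<dots> = norm A * norm x"
    unfolding norm_vec_def[of A] by (simp add: L2_set_left_distrib)
  finally show ?thesis .
qed

lemma inner_matrix_vector_le:
  fixes A :: "real^'d^'d"
  shows "\<bar>v \<bullet> (A *v v)\<bar> \<le> norm A * (norm v)\<^sup>2"
proof -
  have "\<bar>v \<bullet> (A *v v)\<bar> \<le> norm v * norm (A *v v)"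
    by (rule Cauchy_Schwarz_ineq2)
  also have "\<dots> \<le> norm v * (norm A * norm v)"
    by (intro mult_left_mono norm_matrix_vector_le) simp
  finally show ?thesis by (simp add: power2_eq_square mult_ac)
qed

lemma norm_matrix_vector_le_spectral:
  fixes A :: "real^'b^'a"
  shows "norm (A *v x) \<le> spectral_norm A * norm x"
  unfolding spectral_norm_def by (rule onorm) simp

lemma spectral_norm_nonneg: "0 \<le> spectral_norm A" for A :: "real^'b^'a"
  unfolding spectral_norm_def by (rule onorm_pos_le) simp

lemma spectral_norm_le_norm:
  fixes A :: "real^'b^'a"
  shows "spectral_norm A \<le> norm A"
  unfolding spectral_norm_def by (rule onorm_le) (rule norm_matrix_vector_le)

text \<open>
  The comparison lets the consensus argument run in the Frobenius norm, where the space of matrices is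
  Euclidean, although Hessians are only known to be Lipschitz in the spectral norm.
\<close>

lemma norm_le_spectral_norm:
  fixes A :: "real^'b^'a"
  shows "norm A \<le> real CARD('a) * real CARD('b) * spectral_norm A"
proof -
  have "norm A \<le> (\<Sum>i\<in>UNIV. norm (A $ i))"
    unfolding norm_vec_def[of A] by (rule L2_set_le_sum) simp
  also have "\<dots> \<le> (\<Sum>i\<in>UNIV. \<Sum>j\<in>UNIV. \<bar>A $ i $ j\<bar>)"
    by (intro sum_mono norm_le_l1_cart)
  also have "\<dots> \<le> (\<Sum>i\<in>(UNIV::'a set). \<Sum>j\<in>(UNIV::'b set). spectral_norm A)"
    unfolding spectral_norm_def by (intro sum_mono matrix_component_le_onorm)
  finally show ?thesis by simp
qed

text \<open>
  A positive semidefinite form satisfies the Cauchy-Schwarz inequality even where it is degenerate: the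
  discriminant of \<open>t \<mapsto> (x + t y) \<bullet> B (x + t y)\<close> is not positive.
\<close>

lemma psd_Cauchy_Schwarz:
  fixes B :: "real^'d^'d"
  assumes sym: "transpose B = B" and psd: "\<And>v. 0 \<le> v \<bullet> (B *v v)"
  shows "(x \<bullet> (B *v y))\<^sup>2 \<le> (x \<bullet> (B *v x)) * (y \<bullet> (B *v y))"
proof -
  define a b c where "a = x \<bullet> (B *v x)" and "b = x \<bullet> (B *v y)" and "c = y \<bullet> (B *v y)"
  have quad: "0 \<le> a + 2 * t * b + t\<^sup>2 * c" for t
  proof -
    have "0 \<le> (x + t *\<^sub>R y) \<bullet> (B *v (x + t *\<^sub>R y))"
      by (rule psd)
    also have "\<dots> = a + 2 * t * b + t\<^sup>2 * c"
      using symmetric_matrix_inner[OF sym, of y x]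
      by (simp add: a_def b_def c_def matrix_vector_right_distrib inner_add_left inner_add_right
          matrix_vector_mult_scaleR power2_eq_square algebra_simps)
    finally show ?thesis .
  qed
  have "a \<ge> 0" "c \<ge> 0"
    using psd unfolding a_def c_def by auto
  have "b\<^sup>2 \<le> a * c"
  proof (cases "c = 0")
    case True
    have "b = 0"
    proof (rule ccontr)
      assume "b \<noteq> 0"
      then show False
        \<comment> \<open>With \<open>c = 0\<close> the form is affine in \<open>t\<close>; this \<open>t\<close> gives it the value \<open>-1\<close>.\<close>
        using quad[of "- (a + 1) / (2 * b)"] True by (simp add: field_simps)
    qed
    then show ?thesis using True by simp
  next
    case False
    with \<open>c \<ge> 0\<close> have "c > 0" by simp
    have "0 \<le> c * (a + 2 * (- b / c) * b + (- b / c)\<^sup>2 * c)"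
      using quad[of "- b / c"] \<open>c > 0\<close> by simp
    also have "\<dots> = a * c - b\<^sup>2"
      using \<open>c > 0\<close> by (simp add: field_simps power2_eq_square)
    finally show ?thesis by simp
  qed
  then show ?thesis by (simp add: a_def b_def c_def)
qed

text \<open>
  Cauchy-Schwarz with \<open>x = B v\<close>. This is what turns the curvature term \<open>s \<bullet> B s\<close> of a Newton step
  into a multiple of the squared gradient norm.
\<close>

lemma psd_norm_le:
  fixes B :: "real^'d^'d"
  assumes sym: "transpose B = B" and psd: "\<And>v. 0 \<le> v \<bullet> (B *v v)"
  shows "(norm (B *v v))\<^sup>2 \<le> norm B * (v \<bullet> (B *v v))"
proof (cases "B *v v = 0")
  case True
  then show ?thesis by simp
next
  case False
  let ?w = "B *v v"
  have "(?w \<bullet> ?w)\<^sup>2 \<le> (?w \<bullet> (B *v ?w)) * (v \<bullet> ?w)"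
    using psd_Cauchy_Schwarz[OF sym psd, of ?w v] .
  also have "\<dots> \<le> (norm B * (norm ?w)\<^sup>2) * (v \<bullet> ?w)"
    using inner_matrix_vector_le[of ?w B] psd[of v] by (intro mult_right_mono) auto
  finally have "(norm ?w)\<^sup>2 * (norm ?w)\<^sup>2 \<le> (norm ?w)\<^sup>2 * (norm B * (v \<bullet> ?w))"
    unfolding power2_norm_eq_inner power2_eq_square[of "?w \<bullet> ?w"] by (simp only: mult_ac)
  moreover have "0 < (norm ?w)\<^sup>2"
    using False by simp
  ultimately show ?thesis
    by (rule mult_left_le_imp_le)
qed

lemma psd_kernel:
  fixes B :: "real^'d^'d"
  assumes "transpose B = B" and "\<And>v. 0 \<le> v \<bullet> (B *v v)" and "u \<bullet> (B *v u) = 0"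
  shows "B *v u = 0"
  using psd_norm_le[OF assms(1,2), of u] assms(3) by simp

text \<open>
  The least value \<open>\<mu>\<close> of the Rayleigh quotient is attained on the sphere by compactness. A minimiser
  lies in the kernel of the positive semidefinite \<open>A - \<mu> I\<close>, so \<open>\<mu>\<close> is an eigenvalue; it is the least
  one, since the Rayleigh quotient of an eigenvector is its eigenvalue.
\<close>

lemma min_eigenvalue_Rayleigh:
  fixes A :: "real^'d^'d"
  assumes sym: "transpose A = A"
  obtains u where "norm u = 1" "A *v u = min_eigenvalue A *\<^sub>R u"
    "\<And>v. min_eigenvalue A * (norm v)\<^sup>2 \<le> v \<bullet> (A *v v)"
proof -
  have "compact (sphere (0::real^'d) 1)" by simp
  moreover have "sphere (0::real^'d) 1 \<noteq> {}" by simp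
  moreover have "continuous_on (sphere 0 1) (\<lambda>v. v \<bullet> (A *v v))"
    by (intro continuous_intros linear_continuous_on) simp
  ultimately obtain u where u: "norm u = 1"
      and least: "\<And>v. norm v = 1 \<Longrightarrow> u \<bullet> (A *v u) \<le> v \<bullet> (A *v v)"
    using continuous_attains_inf[of "sphere (0::real^'d) 1"] by (metis mem_sphere_0)
  define \<mu> where "\<mu> = u \<bullet> (A *v u)"
  have ray: "\<mu> * (norm v)\<^sup>2 \<le> v \<bullet> (A *v v)" for v
  proof (cases "v = 0")
    case False
    define w where "w = v /\<^sub>R norm v"
    have v: "v = norm v *\<^sub>R w" and w: "norm w = 1"
      using False by (simp_all add: w_def)
    have "v \<bullet> (A *v v) = (norm v)\<^sup>2 * (w \<bullet> (A *v w))"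
      by (subst (1 2) v) (simp add: matrix_vector_mult_scaleR power2_eq_square)
    moreover have "\<mu> \<le> w \<bullet> (A *v w)"
      using least[OF w] by (simp add: \<mu>_def)
    ultimately show ?thesis
      by (simp add: mult.commute[of \<mu>] mult_left_mono)
  qed simp
  define B where "B = A - \<mu> *\<^sub>R mat 1"
  have B: "B *v v = A *v v - \<mu> *\<^sub>R v" for v
    by (simp add: B_def matrix_vector_mult_diff_rdistrib scaleR_matrix_vector_assoc[symmetric])
  have "transpose B = B"
    by (rule symmetric_matrixI)
      (simp add: B inner_diff_right symmetric_matrix_inner[OF sym] inner_commute)
  moreover have "0 \<le> v \<bullet> (B *v v)" for v
    using ray[of v] by (simp add: B inner_diff_right power2_norm_eq_inner)
  moreover have "u \<bullet> (B *v u) = 0"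
    using u by (simp add: B inner_diff_right \<mu>_def power2_norm_eq_inner[symmetric])
  ultimately have "B *v u = 0" by (rule psd_kernel)
  then have eig: "A *v u = \<mu> *\<^sub>R u" by (simp add: B)
  have "min_eigenvalue A = \<mu>"
    unfolding min_eigenvalue_def
  proof (rule Least_equality)
    show "\<exists>v. v \<noteq> 0 \<and> A *v v = \<mu> *\<^sub>R v"
      using eig u by (metis norm_zero zero_neq_one)
  next
    fix \<nu> assume "\<exists>v. v \<noteq> 0 \<and> A *v v = \<nu> *\<^sub>R v"
    then obtain v where "v \<noteq> 0" "A *v v = \<nu> *\<^sub>R v" by blast
    then show "\<mu> \<le> \<nu>"
      using ray[of v] by (simp add: power2_norm_eq_inner)
  qed
  with that u eig ray show ?thesis by blast
qed

lemma min_eigenvalue_shift_psd: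
  fixes A :: "real^'d^'d"
  assumes "transpose A = A"
  shows "0 \<le> v \<bullet> (A *v v) + max 0 (- min_eigenvalue A) * (norm v)\<^sup>2"
proof -
  have "min_eigenvalue A * (norm v)\<^sup>2 \<le> v \<bullet> (A *v v)"
    using min_eigenvalue_Rayleigh[OF assms] by metis
  moreover have "- min_eigenvalue A * (norm v)\<^sup>2 \<le> max 0 (- min_eigenvalue A) * (norm v)\<^sup>2"
    by (intro mult_right_mono) auto
  ultimately show ?thesis by simp
qed

text \<open>
  The shift is controlled by the distance to any positive semidefinite matrix; it therefore vanishes in
  the limit along the run.
\<close>

lemma min_eigenvalue_shift_le:
  fixes A P :: "real^'d^'d"
  assumes "transpose A = A" and psd: "\<And>v. 0 \<le> v \<bullet> (P *v v)"
  shows "max 0 (- min_eigenvalue A) \<le> norm (A - P)"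
proof -
  obtain u where u: "norm u = 1" "A *v u = min_eigenvalue A *\<^sub>R u"
    using min_eigenvalue_Rayleigh[OF assms(1)] by metis
  have "min_eigenvalue A = u \<bullet> (A *v u)"
    using u by (simp add: power2_norm_eq_inner[symmetric])
  also have "\<dots> = u \<bullet> (P *v u) + u \<bullet> ((A - P) *v u)"
    by (simp add: matrix_vector_mult_diff_rdistrib inner_diff_right)
  finally have "- min_eigenvalue A \<le> norm (A - P)"
    using psd[of u] inner_matrix_vector_le[of u "A - P"] u by simp
  then show ?thesis by simp
qed

section \<open>Gradients and Hessians\<close>

lemma gradient_eqI:
  assumes "(\<phi> has_derivative (\<lambda>h. h \<bullet> g)) (at x)"
  shows "gradient \<phi> x = g"
  unfolding gradient_def gderiv_def
proof (rule the_equality)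
  fix v assume "(\<phi> has_derivative (\<lambda>h. h \<bullet> v)) (at x)"
  then have "(\<lambda>h. h \<bullet> v) = (\<lambda>h. h \<bullet> g)"
    using assms by (rule has_derivative_unique)
  then show "v = g"
    by (metis inner_commute vector_eq_rdot)
qed (rule assms)

lemma gradient_works:
  fixes \<phi> :: "real^'d \<Rightarrow> real"
  assumes "\<phi> differentiable (at x)"
  shows "(\<phi> has_derivative (\<lambda>h. h \<bullet> gradient \<phi> x)) (at x)"
proof -
  obtain \<phi>' where d: "(\<phi> has_derivative \<phi>') (at x)"
    using assms by (auto simp: differentiable_def)
  have "\<phi>' h = h \<bullet> adjoint \<phi>' 1" for h
    using adjoint_works[OF has_derivative_linear[OF d], of h 1] by simp
  then have "(\<phi> has_derivative (\<lambda>h. h \<bullet> adjoint \<phi>' 1)) (at x)"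
    using d by (metis ext)
  then show ?thesis using gradient_eqI by metis
qed

lemma hessian_works:
  assumes "gradient \<phi> differentiable (at x)"
  shows "(gradient \<phi> has_derivative (\<lambda>h. hessian \<phi> x *v h)) (at x)"
  using assms unfolding hessian_def by (simp add: jacobian_works)

locale smooth_function =
  fixes F :: "real^'d \<Rightarrow> real" and G :: "real^'d \<Rightarrow> real^'d" and H :: "real^'d \<Rightarrow> real^'d^'d"
  assumes grad: "\<And>x. (F has_derivative (\<lambda>h. h \<bullet> G x)) (at x)"
    and hess: "\<And>x. (G has_derivative (\<lambda>h. H x *v h)) (at x)"
begin

lemma line_deriv: "((\<lambda>t. F (x + t *\<^sub>R v)) has_real_derivative v \<bullet> G (x + t *\<^sub>R v)) (at t)"
proof -
  have "((\<lambda>t. F (x + t *\<^sub>R v)) has_derivative (\<lambda>h. (h *\<^sub>R v) \<bullet> G (x + t *\<^sub>R v))) (at t)"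
    by (rule has_derivative_compose[where f = "\<lambda>t. x + t *\<^sub>R v", OF _ grad])
      (auto intro!: derivative_eq_intros)
  then show ?thesis
    by (simp add: has_field_derivative_def mult_commute_abs)
qed

lemma line_deriv2:
  "((\<lambda>t. v \<bullet> G (x + t *\<^sub>R v)) has_real_derivative v \<bullet> (H (x + t *\<^sub>R v) *v v)) (at t)"
proof -
  have "((\<lambda>t. G (x + t *\<^sub>R v)) has_derivative (\<lambda>h. H (x + t *\<^sub>R v) *v (h *\<^sub>R v))) (at t)"
    by (rule has_derivative_compose[where f = "\<lambda>t. x + t *\<^sub>R v", OF _ hess])
      (auto intro!: derivative_eq_intros)
  then have "((\<lambda>t. v \<bullet> G (x + t *\<^sub>R v)) has_derivative
      (\<lambda>h. v \<bullet> (H (x + t *\<^sub>R v) *v (h *\<^sub>R v)))) (at t)"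
    by (rule has_derivative_inner_right)
  then show ?thesis
    by (simp add: has_field_derivative_def matrix_vector_mult_scaleR mult_commute_abs)
qed

text \<open>
  The second difference is asymptotically \<open>h\<^sup>2 w \<bullet> H u\<close>: by the mean value theorem along \<open>w\<close> it is a
  difference of gradients at two points within \<open>O(h)\<close> of \<open>x\<close>, to which differentiability of the
  gradient at \<open>x\<close> applies. The second difference is symmetric in \<open>u\<close> and \<open>w\<close>, which makes the Hessian
  symmetric.
\<close>

lemma mixed_difference:
  assumes "e > 0"
  shows "\<exists>d>0. \<forall>h. 0 < h \<and> h < d \<longrightarrow>
    \<bar>F (x + h *\<^sub>R u + h *\<^sub>R w) - F (x + h *\<^sub>R u) - F (x + h *\<^sub>R w) + F x - h\<^sup>2 * (w \<bullet> (H x *v u))\<bar>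
      \<le> 2 * e * h\<^sup>2 * (norm u + norm w)\<^sup>2"
proof -
  define n where "n = norm u + norm w"
  have "n \<ge> 0" by (simp add: n_def)
  obtain d0 where "d0 > 0"
    and d0: "\<And>y. norm (y - x) < d0 \<Longrightarrow> norm (G y - G x - H x *v (y - x)) \<le> e * norm (y - x)"
    using hess[of x] assms unfolding has_derivative_at_alt by blast
  define d where "d = d0 / (n + 1)"
  have "d > 0" using \<open>d0 > 0\<close> \<open>n \<ge> 0\<close> by (simp add: d_def)
  moreover have "\<bar>F (x + h *\<^sub>R u + h *\<^sub>R w) - F (x + h *\<^sub>R u) - F (x + h *\<^sub>R w) + F x - h\<^sup>2 * (w \<bullet> (H x *v u))\<bar>
      \<le> 2 * e * h\<^sup>2 * n\<^sup>2" if h: "0 < h" "h < d" for h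
  proof -
    define \<psi> where "\<psi> t = F ((x + h *\<^sub>R u) + t *\<^sub>R w) - F (x + t *\<^sub>R w)" for t
    have "\<exists>z>0. z < h \<and> \<psi> h - \<psi> 0 =
        (h - 0) * (w \<bullet> G ((x + h *\<^sub>R u) + z *\<^sub>R w) - w \<bullet> G (x + z *\<^sub>R w))"
      using h unfolding \<psi>_def by (intro MVT2 DERIV_diff line_deriv)
    then obtain z where z: "0 < z" "z < h"
      and \<psi>: "\<psi> h - \<psi> 0 = h * (w \<bullet> (G ((x + h *\<^sub>R u) + z *\<^sub>R w) - G (x + z *\<^sub>R w)))"
      by (auto simp: inner_diff_right)
    define r where "r y = G y - G x - H x *v (y - x)" for y
    have hn: "h * n < d0"
    proof -
      have "h * n \<le> h * (n + 1)" using h by simp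
      also have "\<dots> < d0" using h \<open>n \<ge> 0\<close> by (simp add: d_def field_simps)
      finally show ?thesis .
    qed
    have r: "norm (r y) \<le> e * (h * n)" if "norm (y - x) \<le> h * n" for y
    proof -
      have "norm (r y) \<le> e * norm (y - x)"
        using d0 that hn unfolding r_def by simp
      also have "\<dots> \<le> e * (h * n)"
        using that assms by (intro mult_left_mono) auto
      finally show ?thesis .
    qed
    have zw: "z * norm w \<le> h * norm w"
      using z by (intro mult_right_mono) auto
    have 1: "norm (((x + h *\<^sub>R u) + z *\<^sub>R w) - x) \<le> h * n"
      using norm_triangle_ineq[of "h *\<^sub>R u" "z *\<^sub>R w"] zw h z
      by (simp add: n_def algebra_simps)
    have hw: "h * norm w \<le> h * n" using h by (simp add: n_def)
    have "norm ((x + z *\<^sub>R w) - x) = z * norm w"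
      using z by simp
    with zw hw have 2: "norm ((x + z *\<^sub>R w) - x) \<le> h * n" by linarith
    have "G ((x + h *\<^sub>R u) + z *\<^sub>R w) - G (x + z *\<^sub>R w)
        = h *\<^sub>R (H x *v u) + (r ((x + h *\<^sub>R u) + z *\<^sub>R w) - r (x + z *\<^sub>R w))"
      by (simp add: r_def algebra_simps matrix_vector_mult_scaleR
          matrix_vector_right_distrib matrix_vector_mult_diff_distrib)
    with \<psi> have "\<psi> h - \<psi> 0 = h * (w \<bullet> (h *\<^sub>R (H x *v u)
        + (r ((x + h *\<^sub>R u) + z *\<^sub>R w) - r (x + z *\<^sub>R w))))"
      by simp
    then have "\<psi> h - \<psi> 0 - h\<^sup>2 * (w \<bullet> (H x *v u))
        = h * (w \<bullet> (r ((x + h *\<^sub>R u) + z *\<^sub>R w) - r (x + z *\<^sub>R w)))"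
      by (simp add: inner_add_right power2_eq_square distrib_left)
    also have "\<bar>\<dots>\<bar> \<le> h * (norm w * (e * (h * n) + e * (h * n)))"
    proof -
      have "norm (r ((x + h *\<^sub>R u) + z *\<^sub>R w) - r (x + z *\<^sub>R w)) \<le> e * (h * n) + e * (h * n)"
        by (rule norm_triangle_le_diff) (intro add_mono r 1 2)
      then have "\<bar>w \<bullet> (r ((x + h *\<^sub>R u) + z *\<^sub>R w) - r (x + z *\<^sub>R w))\<bar>
          \<le> norm w * (e * (h * n) + e * (h * n))"
        by (intro order_trans[OF Cauchy_Schwarz_ineq2] mult_left_mono) auto
      then show ?thesis using h by (simp add: abs_mult)
    qed
    also have "\<dots> \<le> h * (n * (e * (h * n) + e * (h * n)))"
      using h \<open>e > 0\<close> \<open>n \<ge> 0\<close> by (intro mult_left_mono mult_right_mono) (auto simp: n_def)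
    finally show ?thesis
      by (simp add: \<psi>_def power2_eq_square algebra_simps)
  qed
  ultimately show ?thesis unfolding n_def by blast
qed

lemma hessian_symmetric: "transpose (H x) = H x"
proof (rule symmetric_matrixI)
  fix u w :: "real^'d"
  define n where "n = norm u + norm w"
  have le: "\<bar>w \<bullet> (H x *v u) - u \<bullet> (H x *v w)\<bar> \<le> 4 * n\<^sup>2 * e" if e: "e > 0" for e
  proof -
    obtain d1 d2 where "d1 > 0" "d2 > 0"
      and d1: "\<And>h. 0 < h \<Longrightarrow> h < d1 \<Longrightarrow> \<bar>F (x + h *\<^sub>R u + h *\<^sub>R w) - F (x + h *\<^sub>R u) - F (x + h *\<^sub>R w)
          + F x - h\<^sup>2 * (w \<bullet> (H x *v u))\<bar> \<le> 2 * e * h\<^sup>2 * n\<^sup>2"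
      and d2: "\<And>h. 0 < h \<Longrightarrow> h < d2 \<Longrightarrow> \<bar>F (x + h *\<^sub>R w + h *\<^sub>R u) - F (x + h *\<^sub>R w) - F (x + h *\<^sub>R u)
          + F x - h\<^sup>2 * (u \<bullet> (H x *v w))\<bar> \<le> 2 * e * h\<^sup>2 * n\<^sup>2"
      using mixed_difference[OF e, of x u w] mixed_difference[OF e, of x w u]
      unfolding n_def by (auto simp: add.commute)
    obtain h where h: "0 < h" "h < d1" "h < d2"
      using \<open>d1 > 0\<close> \<open>d2 > 0\<close> field_lbound_gt_zero by blast
    have swap: "x + h *\<^sub>R w + h *\<^sub>R u = x + h *\<^sub>R u + h *\<^sub>R w" by simp
    have "\<bar>h\<^sup>2 * (w \<bullet> (H x *v u)) - h\<^sup>2 * (u \<bullet> (H x *v w))\<bar> \<le> 4 * e * h\<^sup>2 * n\<^sup>2"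
      using d1[OF h(1,2)] d2[OF h(1,3)] unfolding swap by linarith
    then have "h\<^sup>2 * \<bar>w \<bullet> (H x *v u) - u \<bullet> (H x *v w)\<bar> \<le> h\<^sup>2 * (4 * n\<^sup>2 * e)"
      by (simp add: right_diff_distrib[symmetric] abs_mult mult_ac)
    then show ?thesis using h by simp
  qed
  have "\<bar>w \<bullet> (H x *v u) - u \<bullet> (H x *v w)\<bar> \<le> 0 + e" if "e > 0" for e
  proof -
    have "\<bar>w \<bullet> (H x *v u) - u \<bullet> (H x *v w)\<bar> \<le> 4 * n\<^sup>2 * (e / (4 * n\<^sup>2 + 1))"
      using that by (intro le) (simp add: add_nonneg_pos)
    also have "\<dots> \<le> e"
    proof -
      have "0 < 4 * n\<^sup>2 + 1" by (simp add: add_nonneg_pos)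
      moreover have "e * (4 * n\<^sup>2) \<le> e * (4 * n\<^sup>2 + 1)"
        using that by (intro mult_left_mono) auto
      ultimately show ?thesis by (simp only: times_divide_eq_right pos_divide_le_eq mult_ac)
    qed
    finally show ?thesis by simp
  qed
  then have "\<bar>w \<bullet> (H x *v u) - u \<bullet> (H x *v w)\<bar> \<le> 0"
    by (rule field_le_epsilon)
  then show "u \<bullet> (H x *v w) = w \<bullet> (H x *v u)" by simp
qed

text \<open>
  Taylor with Lagrange remainder: moving the Hessian from the intermediate point to \<open>x\<close> costs
  \<open>L / 2 |v|^3\<close>, which a regularisation \<open>\<lambda> \<ge> L |v|\<close> can still absorb through \<open>\<lambda> / 2 |v|\<^sup>2\<close>.
\<close>

lemma cubic_upper_bound:
  assumes lip: "\<And>x y. spectral_norm (H x - H y) \<le> L * norm (x - y)"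
  shows "F (x + v) \<le> F x + v \<bullet> G x + (v \<bullet> (H x *v v)) / 2 + L / 2 * norm v ^ 3"
proof -
  define diff where "diff m t = (if m = (0::nat) then F (x + t *\<^sub>R v)
      else if m = 1 then v \<bullet> G (x + t *\<^sub>R v) else v \<bullet> (H (x + t *\<^sub>R v) *v v))" for m t
  have "\<exists>t. 0 < t \<and> t < 1 \<and> F (x + 1 *\<^sub>R v)
      = (\<Sum>m<2. diff m 0 / fact m * 1 ^ m) + diff 2 t / fact 2 * 1 ^ 2"
    by (rule Maclaurin[where f = "\<lambda>t. F (x + t *\<^sub>R v)"])
      (auto simp: diff_def less_2_cases_iff intro: line_deriv line_deriv2)
  then obtain t where t: "0 < t" "t < 1"
    and eq: "F (x + v) = F x + v \<bullet> G x + (v \<bullet> (H (x + t *\<^sub>R v) *v v)) / 2"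
    by (auto simp: diff_def numeral_2_eq_2)
  have "v \<bullet> (H (x + t *\<^sub>R v) *v v) - v \<bullet> (H x *v v) = v \<bullet> ((H (x + t *\<^sub>R v) - H x) *v v)"
    by (simp add: matrix_vector_mult_diff_rdistrib inner_diff_right)
  also have "\<dots> \<le> norm v * norm ((H (x + t *\<^sub>R v) - H x) *v v)"
    by (rule norm_cauchy_schwarz)
  also have "\<dots> \<le> norm v * ((L * norm v) * norm v)"
  proof (intro mult_left_mono order_trans[OF norm_matrix_vector_le_spectral] mult_right_mono)
    have "spectral_norm (H (x + t *\<^sub>R v) - H x) \<le> L * (t * norm v)"
      using lip[of "x + t *\<^sub>R v" x] t by simp
    also have "\<dots> \<le> L * norm v"
    proof -
      have "0 \<le> L * norm v"
        using lip[of v 0] spectral_norm_nonneg[of "H v - H 0"] by simp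
      then have "t * (L * norm v) \<le> 1 * (L * norm v)"
        using t by (intro mult_right_mono) auto
      then show ?thesis by (simp add: mult_ac)
    qed
    finally show "spectral_norm (H (x + t *\<^sub>R v) - H x) \<le> L * norm v" .
  qed auto
  finally show ?thesis
    using eq by (simp add: power3_eq_cube mult_ac)
qed

context
  assumes convex: "convex_on UNIV F"
begin

lemma above_tangent: "F x + (y - x) \<bullet> G x \<le> F y"
proof -
  have "convex_on UNIV (\<lambda>t. F (x + t *\<^sub>R (y - x)))"
  proof (rule convex_onI)
    fix t a b :: real assume t: "0 < t" "t < 1"
    have "x + ((1 - t) *\<^sub>R a + t *\<^sub>R b) *\<^sub>R (y - x)
        = (1 - t) *\<^sub>R (x + a *\<^sub>R (y - x)) + t *\<^sub>R (x + b *\<^sub>R (y - x))"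
      by (simp add: algebra_simps)
    then show "F (x + ((1 - t) *\<^sub>R a + t *\<^sub>R b) *\<^sub>R (y - x))
        \<le> (1 - t) * F (x + a *\<^sub>R (y - x)) + t * F (x + b *\<^sub>R (y - x))"
      using convex_onD[OF convex, of t] t by simp
  qed simp
  then have "((y - x) \<bullet> G (x + 0 *\<^sub>R (y - x))) * (1 - 0)
      \<le> F (x + 1 *\<^sub>R (y - x)) - F (x + 0 *\<^sub>R (y - x))"
    by (rule convex_on_imp_above_tangent) (auto intro: line_deriv simp del: scaleR_zero_left)
  then show ?thesis by simp
qed

text \<open>
  Adding the tangent inequalities at \<open>x\<close> and \<open>x + t v\<close> shows that the directional derivative along
  \<open>v\<close> is nondecreasing; its derivative at \<open>0\<close> is the quadratic form.
\<close>

lemma hessian_psd: "0 \<le> v \<bullet> (H x *v v)"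
proof -
  have "((\<lambda>t. (v \<bullet> G (x + t *\<^sub>R v) - v \<bullet> G x) / t) \<longlongrightarrow> v \<bullet> (H x *v v)) (at_right 0)"
    using line_deriv2[of v x 0]
    by (auto simp: has_field_derivative_iff intro: filterlim_at_split[THEN iffD1, THEN conjunct2])
  moreover have "\<forall>\<^sub>F t in at_right 0. 0 \<le> (v \<bullet> G (x + t *\<^sub>R v) - v \<bullet> G x) / t"
  proof (rule eventually_at_rightI[of 0 1])
    fix t :: real assume t: "t \<in> {0<..<1}"
    have "F x + t * (v \<bullet> G x) \<le> F (x + t *\<^sub>R v)"
      and "F (x + t *\<^sub>R v) - t * (v \<bullet> G (x + t *\<^sub>R v)) \<le> F x"
      using above_tangent[of x "x + t *\<^sub>R v"] above_tangent[of "x + t *\<^sub>R v" x] by simp_all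
    then have "t * (v \<bullet> G x) \<le> t * (v \<bullet> G (x + t *\<^sub>R v))" by linarith
    then show "0 \<le> (v \<bullet> G (x + t *\<^sub>R v) - v \<bullet> G x) / t" using t by simp
  qed simp
  ultimately show ?thesis
    by (rule tendsto_lowerbound) simp
qed

end

end

section \<open>Consensus\<close>

lemma avg_add: "avg (\<lambda>i. u i + v i) = avg u + avg v"
  by (simp add: avg_def sum.distrib scaleR_right_distrib)

lemma avg_diff: "avg (\<lambda>i. u i - v i) = avg u - avg v"
  by (simp add: avg_def sum_subtractf scaleR_right_diff_distrib)

lemma avg_const [simp]: "avg (\<lambda>i::'n::finite. c) = c"
  by (simp add: avg_def sum_constant_scaleR)

lemma avg_mult_left: "avg (\<lambda>i. c * v i) = c * avg v" for c :: real
  by (simp add: avg_def sum_distrib_left[symmetric] mult.left_commute)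

lemma avg_mono: "(\<And>i. u i \<le> v i) \<Longrightarrow> avg u \<le> avg v" for u v :: "'n::finite \<Rightarrow> real"
  by (simp add: avg_def sum_mono mult_left_mono)

lemma avg_linear:
  assumes "linear h"
  shows "h (avg v) = avg (\<lambda>i. h (v i))"
  using assms by (simp add: avg_def linear_cmul linear_sum)

lemma norm_avg_le: "norm (avg v) \<le> avg (\<lambda>i. norm (v i))" for v :: "'n::finite \<Rightarrow> 'v::real_normed_vector"
  by (simp add: avg_def norm_sum mult_left_mono)

lemma norm_avg_bound:
  fixes v :: "'n::finite \<Rightarrow> 'v::real_normed_vector"
  assumes "\<And>i. norm (v i) \<le> b"
  shows "norm (avg v) \<le> b"
  using norm_avg_le[of v] avg_mono[of "\<lambda>i. norm (v i)" "\<lambda>_. b"] assms by simp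

text \<open>
  The disagreement among the agents as a seminorm: the Euclidean distance of the stacked vector from the
  consensus subspace.
\<close>

definition spread :: "('n::finite \<Rightarrow> 'v::real_normed_vector) \<Rightarrow> real" where
  "spread v = L2_set (\<lambda>i. norm (v i - avg v)) UNIV"

lemma spread_nonneg: "0 \<le> spread v"
  by (simp add: spread_def)

lemma norm_diff_avg_le_spread: "norm (v i - avg v) \<le> spread v"
  unfolding spread_def by (rule member_le_L2_set) simp_all

lemma spread_add_le: "spread (\<lambda>i. u i + v i) \<le> spread u + spread v"
proof -
  have "spread (\<lambda>i. u i + v i) \<le> L2_set (\<lambda>i. norm (u i - avg u) + norm (v i - avg v)) UNIV"
    unfolding spread_def
    by (rule L2_set_mono) (auto simp only: avg_add add_diff_add norm_triangle_ineq norm_ge_zero)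
  also have "\<dots> \<le> spread u + spread v"
    unfolding spread_def by (rule L2_set_triangle_ineq)
  finally show ?thesis .
qed

lemma spread_le:
  fixes v :: "'n::finite \<Rightarrow> 'v::real_normed_vector"
  assumes "\<And>i. norm (v i) \<le> b"
  shows "spread v \<le> 2 * real CARD('n) * b"
proof -
  have "norm (v i - avg v) \<le> 2 * b" for i
    using norm_triangle_ineq4[of "v i" "avg v"] assms[of i] norm_avg_bound[of v b, OF assms] by linarith
  then have "(\<Sum>i\<in>(UNIV::'n set). norm (v i - avg v)) \<le> (\<Sum>i\<in>(UNIV::'n set). 2 * b)"
    by (rule sum_mono)
  then show ?thesis
    using L2_set_le_sum[of UNIV "\<lambda>i. norm (v i - avg v)"] by (simp add: spread_def)
qed

lemma mix_0: "mix W 0 v = v"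
proof
  fix i
  have "(\<Sum>j\<in>UNIV. (if i = j then 1 else 0) *\<^sub>R v j) = (\<Sum>j\<in>UNIV. if i = j then v j else 0)"
    by (rule sum.cong) auto
  then show "mix W 0 v i = v i"
    by (simp add: mix_def matrix_power_def mat_def)
qed

lemma mix_Suc: "mix W (Suc m) v i = (\<Sum>j\<in>UNIV. (W $ i $ j) *\<^sub>R mix W m v j)"
proof -
  have "mix W (Suc m) v i
      = (\<Sum>l\<in>UNIV. \<Sum>j\<in>UNIV. (W $ i $ j * matrix_power W m $ j $ l) *\<^sub>R v l)"
    by (simp add: mix_def matrix_power_def matrix_matrix_mult_def scaleR_sum_left)
  also have "\<dots> = (\<Sum>j\<in>UNIV. \<Sum>l\<in>UNIV. (W $ i $ j * matrix_power W m $ j $ l) *\<^sub>R v l)"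
    by (rule sum.swap)
  finally show ?thesis
    by (simp add: mix_def scaleR_sum_right)
qed

lemma mix_symmetric:
  fixes v :: "'n::finite \<Rightarrow> real^'d^'d"
  assumes "\<And>j. transpose (v j) = v j"
  shows "transpose (mix W m v i) = mix W m v i"
proof -
  have "v j $ a $ b = v j $ b $ a" for j a b
    using assms[of j] by (simp add: transpose_def vec_eq_iff)
  then show ?thesis
    by (simp add: mix_def transpose_def vec_eq_iff sum_component)
qed

context
  fixes W :: "real^'n^'n"
  assumes W: "mixing_matrix W"
begin

lemma avg_mix_step:
  fixes v :: "'n \<Rightarrow> 'v::real_vector"
  shows "avg (\<lambda>i. \<Sum>j\<in>UNIV. (W $ i $ j) *\<^sub>R v j) = avg v"
proof -
  have "(\<Sum>i\<in>UNIV. \<Sum>j\<in>UNIV. (W $ i $ j) *\<^sub>R v j) = (\<Sum>j\<in>UNIV. (\<Sum>i\<in>UNIV. W $ i $ j) *\<^sub>R v j)"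
    by (subst sum.swap) (simp add: scaleR_sum_left)
  then show ?thesis
    using W by (simp add: avg_def mixing_matrix_def)
qed

lemma avg_mix: "avg (mix W m v) = avg v"
  by (induction m) (simp_all add: mix_0 mix_Suc[abs_def] avg_mix_step)

text \<open>
  Coordinatewise, mixing acts on the deviation \<open>u\<close> from the mean as \<open>W\<close> and hence, as the coordinates
  of \<open>u\<close> sum to \<open>0\<close>, as \<open>W - J\<close> with \<open>J\<close> the averaging matrix. Summing over an orthonormal basis
  transfers the bound to vectors and, in the Frobenius norm, to matrices.
\<close>

lemma spread_mix_step:
  fixes v :: "'n \<Rightarrow> 'v::euclidean_space"
  shows "spread (\<lambda>i. \<Sum>j\<in>UNIV. (W $ i $ j) *\<^sub>R v j) \<le> contraction_factor W * spread v"
proof -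
  let ?J = "(\<chi> i j. 1 / real CARD('n)) :: real^'n^'n"
  define u where "u i = v i - avg v" for i
  define y where "y i = (\<Sum>j\<in>UNIV. (W $ i $ j) *\<^sub>R v j) - avg v" for i
  define \<rho> where "\<rho> = contraction_factor W"
  have "\<rho> \<ge> 0" by (simp add: \<rho>_def contraction_factor_def spectral_norm_nonneg)
  have sum_u: "(\<Sum>j\<in>UNIV. u j) = 0"
    by (simp add: u_def sum_subtractf avg_def sum_constant_scaleR)
  have y: "y i = (\<Sum>j\<in>UNIV. (W $ i $ j) *\<^sub>R u j)" for i
  proof -
    have "(\<Sum>j\<in>UNIV. (W $ i $ j) *\<^sub>R avg v) = avg v"
      using W by (simp add: mixing_matrix_def scaleR_sum_left[symmetric])
    then show ?thesis
      by (simp add: y_def u_def scaleR_right_diff_distrib sum_subtractf)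
  qed
  have coord: "(\<Sum>i\<in>UNIV. (y i \<bullet> b)\<^sup>2) \<le> \<rho>\<^sup>2 * (\<Sum>i\<in>UNIV. (u i \<bullet> b)\<^sup>2)" for b
  proof -
    define a where "a = (\<chi> i. u i \<bullet> b)"
    have "(\<Sum>j\<in>UNIV. u j \<bullet> b) = 0"
      using sum_u by (simp add: inner_sum_left[symmetric])
    then have "(W - ?J) *v a = (\<chi> i. y i \<bullet> b)"
      by (simp add: vec_eq_iff matrix_vector_mult_def a_def y inner_sum_left left_diff_distrib
          sum_subtractf sum_divide_distrib[symmetric])
    then have "norm (\<chi> i. y i \<bullet> b) \<le> \<rho> * norm a"
      using norm_matrix_vector_le_spectral[of "W - ?J" a]
      by (simp add: \<rho>_def contraction_factor_def)
    then have "(norm (\<chi> i. y i \<bullet> b))\<^sup>2 \<le> (\<rho> * norm a)\<^sup>2"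
      by (rule power_mono) simp
    then show ?thesis
      by (simp add: norm_vec_def L2_set_def a_def power_mult_distrib sum_nonneg)
  qed
  have coords: "(\<Sum>i\<in>UNIV. (norm (z i))\<^sup>2) = (\<Sum>b\<in>Basis. \<Sum>i\<in>UNIV. (z i \<bullet> b)\<^sup>2)"
    for z :: "'n \<Rightarrow> 'v"
  proof -
    have "(norm x)\<^sup>2 = (\<Sum>b\<in>Basis. (x \<bullet> b)\<^sup>2)" for x :: 'v
      by (subst power2_norm_eq_inner, subst euclidean_inner) (simp add: power2_eq_square)
    then show ?thesis by (subst sum.swap) simp
  qed
  have "(\<Sum>i\<in>UNIV. (norm (y i))\<^sup>2) \<le> \<rho>\<^sup>2 * (\<Sum>i\<in>UNIV. (norm (u i))\<^sup>2)"
    unfolding coords sum_distrib_left[of "\<rho>\<^sup>2" _ Basis] by (intro sum_mono coord)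
  then have "L2_set (\<lambda>i. norm (y i)) UNIV \<le> sqrt (\<rho>\<^sup>2 * (\<Sum>i\<in>UNIV. (norm (u i))\<^sup>2))"
    by (simp add: L2_set_def)
  also have "\<dots> = \<rho> * spread v"
    using \<open>\<rho> \<ge> 0\<close> by (simp add: real_sqrt_mult spread_def L2_set_def u_def)
  finally show ?thesis
    by (simp add: spread_def y_def avg_mix_step \<rho>_def)
qed

lemma spread_mix:
  fixes v :: "'n \<Rightarrow> 'v::euclidean_space"
  shows "spread (mix W m v) \<le> contraction_factor W ^ m * spread v"
proof (induction m)
  case 0
  then show ?case by (simp add: mix_0)
next
  case (Suc m)
  have "spread (mix W (Suc m) v) \<le> contraction_factor W * spread (mix W m v)"
    using spread_mix_step[of "mix W m v"] by (simp add: mix_Suc[abs_def])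
  also have "\<dots> \<le> contraction_factor W * (contraction_factor W ^ m * spread v)"
    by (intro mult_left_mono Suc) (simp add: contraction_factor_def spectral_norm_nonneg)
  finally show ?case by (simp add: mult.assoc)
qed

lemma spread_mix_le:
  fixes v :: "'n \<Rightarrow> 'v::euclidean_space"
  shows "spread (mix W m v) \<le> spread v"
proof -
  have "contraction_factor W ^ m \<le> 1"
    using W by (intro power_le_one) (auto simp: mixing_matrix_def contraction_factor_def spectral_norm_nonneg)
  then have "contraction_factor W ^ m * spread v \<le> 1 * spread v"
    by (intro mult_right_mono spread_nonneg)
  with spread_mix[of m v] show ?thesis by simp
qed

end

text \<open>
  The factor \<open>\<epsilon> k\<close> is at most \<open>1 / 2\<close>, which keeps \<open>a\<close> below \<open>a 0 + b\<close>; feeding this bound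
  back once gives the rate of \<open>\<epsilon>\<close>.
\<close>

lemma perturbed_contraction_decay:
  fixes a \<epsilon> :: "nat \<Rightarrow> real"
  assumes a: "\<And>k. 0 \<le> a k" and b: "0 \<le> b"
    and step: "\<And>k. a (Suc k) \<le> \<epsilon> k * (a k + b)" and \<epsilon>: "\<And>k. \<epsilon> k \<le> 1 / (real k + 2)\<^sup>2"
  shows "a k \<le> 2 * (a 0 + b) / (real k + 1)\<^sup>2"
proof -
  have pos: "0 \<le> a 0 + b" using a[of 0] b by simp
  have next_le: "a (Suc k) \<le> (a k + b) / (real k + 2)\<^sup>2" for k
    using step[of k] mult_right_mono[OF \<epsilon>[of k], of "a k + b"] a[of k] b by simp
  have bound: "a k \<le> a 0 + b" for k
  proof (induction k)
    case 0 then show ?case using b by simp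
  next
    case (Suc k)
    have "a (Suc k) \<le> (a k + b) / (real k + 2)\<^sup>2" by (rule next_le)
    also have "\<dots> \<le> (a k + b) / 2"
    proof (rule divide_left_mono)
      have "2 * 2 \<le> (real k + 2) * (real k + 2)" by (intro mult_mono) auto
      then show "2 \<le> (real k + 2)\<^sup>2" by (simp add: power2_eq_square)
    qed (use a b in auto)
    also have "\<dots> \<le> a 0 + b" using Suc a[of 0] by simp
    finally show ?case .
  qed
  show ?thesis
  proof (cases k)
    case 0 then show ?thesis using pos b by simp
  next
    case (Suc l)
    have "a k \<le> (a l + b) / (real l + 2)\<^sup>2" unfolding Suc by (rule next_le)
    also have "\<dots> \<le> 2 * (a 0 + b) / (real l + 2)\<^sup>2"
      using bound[of l] a[of 0] by (intro divide_right_mono) auto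
    finally show ?thesis by (simp add: Suc add.commute)
  qed
qed

lemma log_schedule_decay:
  assumes "p \<ge> 2" "c \<ge> 0" "0 < \<rho>" "\<rho> < 1"
  shows "\<rho> ^ log_schedule p c \<rho> k \<le> 1 / (real k + 2)\<^sup>2"
proof -
  define \<tau> where "\<tau> = log_schedule p c \<rho> k"
  have ln: "ln \<rho> < 0" using assms by simp
  have "(p * ln (real k + 2) + c) / (- ln \<rho>) \<le> real \<tau>"
    unfolding \<tau>_def log_schedule_def by (rule real_nat_ceiling_ge)
  then have "p * ln (real k + 2) + c \<le> real \<tau> * (- ln \<rho>)"
    using ln by (subst (asm) pos_divide_le_eq) auto
  moreover have "2 * ln (real k + 2) \<le> p * ln (real k + 2)"
    using assms by (intro mult_right_mono) auto
  ultimately have "real \<tau> * ln \<rho> \<le> - (2 * ln (real k + 2))"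
    using assms(2) unfolding mult_minus_right by linarith
  then have "ln (\<rho> ^ \<tau>) \<le> ln (1 / (real k + 2)\<^sup>2)"
    using assms by (simp add: ln_realpow ln_div)
  then show ?thesis
    using assms by (subst (asm) ln_le_cancel_iff) (auto simp: \<tau>_def)
qed

section \<open>Tracking errors of a run\<close>

lemma linear_matrix_apply: "linear (\<lambda>A :: real^'b^'a. A *v v)"
  by (rule linearI) (simp_all add: matrix_vector_mult_add_rdistrib scaleR_matrix_vector_assoc)

text \<open>
  One run with arbitrary mixing depths, of which only the decay that the logarithmic schedule provides
  is kept. The initial data are separate parameters, so that constants defined from them and from
  \<open>L1\<close>, \<open>L2\<close>, \<open>D\<close>, \<open>M\<close> alone do not mention \<open>f\<close>, \<open>W\<close> or \<open>r\<close> and are shared by all instances.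
\<close>

locale disgrem_instance =
  fixes f :: "'n::finite \<Rightarrow> real^'d::finite \<Rightarrow> real" and W :: "real^'n^'n"
    and r :: "('n, 'd) run" and \<tau> t :: "nat \<Rightarrow> nat"
    and L1 L2 D M :: real and x0 g0 :: "'n \<Rightarrow> real^'d" and H0 :: "'n \<Rightarrow> real^'d^'d"
  assumes smooth: "smooth_convex f L1 L2" and mixing: "mixing_matrix W"
    and run: "disgrem f W M \<tau> t r" and bounded: "bounded_iterates f D r"
    and init: "run_x r 0 = x0" "run_g r 0 = g0" "run_H r 0 = H0"
    and decay: "\<And>k. contraction_factor W ^ t k \<le> 1 / (real k + 2)\<^sup>2"
    and D_pos: "D > 0" and M_pos: "M > 0" and L2_le_M: "L2 \<le> M"
begin

definition gradF :: "real^'d \<Rightarrow> real^'d" where "gradF x = avg (\<lambda>i. gradient (f i) x)"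
definition hessF :: "real^'d \<Rightarrow> real^'d^'d" where "hessF x = avg (\<lambda>i. hessian (f i) x)"

lemma local_smooth: "smooth_function (f i) (gradient (f i)) (hessian (f i))"
  using smooth unfolding smooth_convex_def twice_cont_diff_def
  by unfold_locales (auto intro: gradient_works hessian_works)

sublocale obj: smooth_function "objective f" gradF hessF
proof
  fix x
  have "((\<lambda>x. (\<Sum>i\<in>UNIV. f i x) /\<^sub>R real CARD('n)) has_derivative
      (\<lambda>h. (\<Sum>i\<in>UNIV. h \<bullet> gradient (f i) x) /\<^sub>R real CARD('n))) (at x)"
    by (intro has_derivative_scaleR_right has_derivative_sum smooth_function.grad[OF local_smooth])
  then show "(objective f has_derivative (\<lambda>h. h \<bullet> gradF x)) (at x)"
    by (simp add: objective_def[abs_def] gradF_def avg_def inner_sum_right)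
  have "((\<lambda>x. (\<Sum>i\<in>UNIV. gradient (f i) x) /\<^sub>R real CARD('n)) has_derivative
      (\<lambda>h. (\<Sum>i\<in>UNIV. hessian (f i) x *v h) /\<^sub>R real CARD('n))) (at x)"
    by (intro has_derivative_scaleR_right has_derivative_sum smooth_function.hess[OF local_smooth])
  moreover have "hessF x *v h = avg (\<lambda>i. hessian (f i) x *v h)" for h
    unfolding hessF_def by (rule avg_linear[OF linear_matrix_apply])
  ultimately show "(gradF has_derivative (\<lambda>h. hessF x *v h)) (at x)"
    by (simp add: gradF_def[abs_def] avg_def)
qed

lemma gradient_objective: "gradient (objective f) x = gradF x"
  by (rule gradient_eqI) (rule obj.grad)

lemma grad_lip: "norm (gradient (f i) x - gradient (f i) y) \<le> L1 * norm (x - y)"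
  using smooth by (simp add: smooth_convex_def)

lemma hess_lip: "spectral_norm (hessian (f i) x - hessian (f i) y) \<le> L2 * norm (x - y)"
  using smooth by (simp add: smooth_convex_def)

lemma L1_nonneg: "0 \<le> L1"
proof -
  obtain e :: "real^'d" where "norm e = 1" using vector_choose_size[of 1] by auto
  moreover have "0 \<le> L1 * norm (e - 0)"
    by (rule order_trans[OF norm_ge_zero grad_lip])
  ultimately show ?thesis by simp
qed

lemma L2_nonneg: "0 \<le> L2"
proof -
  obtain e :: "real^'d" where "norm e = 1" using vector_choose_size[of 1] by auto
  moreover have "0 \<le> L2 * norm (e - 0)"
    by (rule order_trans[OF spectral_norm_nonneg hess_lip])
  ultimately show ?thesis by simp
qed

lemma hess_lip_norm:
  "norm (hessian (f i) x - hessian (f i) y) \<le> (real CARD('d))\<^sup>2 * (L2 * norm (x - y))"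
  unfolding power2_eq_square
  by (rule order_trans[OF norm_le_spectral_norm]) (intro mult_left_mono hess_lip, simp)

lemma hessF_lip: "spectral_norm (hessF x - hessF y) \<le> L2 * norm (x - y)"
  unfolding spectral_norm_def
proof (rule onorm_le)
  fix v
  have "(hessF x - hessF y) *v v = avg (\<lambda>i. (hessian (f i) x - hessian (f i) y) *v v)"
    unfolding hessF_def avg_diff[symmetric] by (rule avg_linear[OF linear_matrix_apply])
  also have "norm \<dots> \<le> L2 * norm (x - y) * norm v"
    by (intro norm_avg_bound order_trans[OF norm_matrix_vector_le_spectral]
        mult_right_mono hess_lip norm_ge_zero)
  finally show "norm ((hessF x - hessF y) *v v) \<le> L2 * norm (x - y) * norm v" .
qed

lemma convex_objective: "convex_on UNIV (objective f)"
proof (rule convex_onI)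
  fix s :: real and x y assume "0 < s" "s < 1"
  then have "objective f ((1 - s) *\<^sub>R x + s *\<^sub>R y) \<le> avg (\<lambda>i. (1 - s) * f i x + s * f i y)"
    using smooth unfolding objective_def smooth_convex_def
    by (intro avg_mono convex_onD[of UNIV]) auto
  then show "objective f ((1 - s) *\<^sub>R x + s *\<^sub>R y) \<le> (1 - s) * objective f x + s * objective f y"
    by (simp add: objective_def avg_add avg_mult_left)
qed simp

lemma objective_avg_le:
  fixes v :: "'m::finite \<Rightarrow> real^'d"
  shows "objective f (avg v) \<le> avg (\<lambda>i. objective f (v i))"
  using convex_on_sum[OF _ _ convex_objective, of "UNIV :: 'm set" "\<lambda>_. 1 / real CARD('m)" v]
  by (simp add: avg_def scaleR_sum_right sum_distrib_left divide_inverse)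

lemmas hessF_psd = obj.hessian_psd[OF convex_objective]

subsection \<open>Averages of the tracked quantities\<close>

lemma tld_x: "tld_x r k = mix W (\<tau> k) (run_x r k)"
  and tld_g: "tld_g r k = mix W (\<tau> k) (run_g r k)"
  and tld_H: "tld_H r k = mix W (\<tau> k) (run_H r k)"
  and run_x_Suc: "run_x r (Suc k) = mix W (t k) (\<lambda>j. tld_x r k j + run_s r k j)"
  and run_g_Suc: "run_g r (Suc k) = mix W (t k) (\<lambda>j. tld_g r k j
        + (gradient (f j) (run_x r (Suc k) j) - gradient (f j) (run_x r k j)))"
  and run_H_Suc: "run_H r (Suc k) = mix W (t k) (\<lambda>j. tld_H r k j
        + (hessian (f j) (run_x r (Suc k) j) - hessian (f j) (run_x r k j)))"
  using run unfolding disgrem_def by (auto simp: add_diff_eq)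

text \<open>
  Gradient tracking: mixing preserves the average, so the increments telescope.
\<close>

lemma avg_tld_g: "avg (tld_g r k) = avg (\<lambda>i. gradient (f i) (run_x r k i))"
proof -
  have "avg (run_g r k) = avg (\<lambda>i. gradient (f i) (run_x r k i))"
  proof (induction k)
    case 0
    then show ?case using run by (simp add: disgrem_def)
  next
    case (Suc k)
    then show ?case
      by (simp add: run_g_Suc avg_mix[OF mixing] avg_add avg_diff tld_g)
  qed
  then show ?thesis by (simp add: tld_g avg_mix[OF mixing])
qed

lemma avg_tld_H: "avg (tld_H r k) = avg (\<lambda>i. hessian (f i) (run_x r k i))"
proof -
  have "avg (run_H r k) = avg (\<lambda>i. hessian (f i) (run_x r k i))"
  proof (induction k)
    case 0
    then show ?case using run by (simp add: disgrem_def)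
  next
    case (Suc k)
    then show ?case
      by (simp add: run_H_Suc avg_mix[OF mixing] avg_add avg_diff tld_H)
  qed
  then show ?thesis by (simp add: tld_H avg_mix[OF mixing])
qed

lemma xbar_Suc: "xbar r (Suc k) = xbar r k + sbar r k"
  by (simp add: xbar_def sbar_def run_x_Suc avg_mix[OF mixing] avg_add tld_x)

lemma tld_H_symmetric: "transpose (tld_H r k i) = tld_H r k i"
proof -
  have hess: "transpose (hessian (f i) x) = hessian (f i) x" for i x
    by (rule smooth_function.hessian_symmetric[OF local_smooth])
  have tr: "transpose (A + (B - C)) = transpose A + (transpose B - transpose C)"
    for A B C :: "real^'d^'d"
    by (simp add: transpose_def vec_eq_iff)
  have "transpose (run_H r k i) = run_H r k i" for i
  proof (induction k arbitrary: i)
    case 0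
    then show ?case using run by (simp add: disgrem_def hess)
  next
    case (Suc k)
    show ?case
      unfolding run_H_Suc tld_H by (intro mix_symmetric) (simp only: tr hess mix_symmetric[OF Suc])
  qed
  then show ?thesis unfolding tld_H by (intro mix_symmetric)
qed

subsection \<open>Decay of the tracking errors\<close>

text \<open>
  Constants for the tracking analysis. A name ending in \<open>spread\<close> or \<open>err\<close> denotes the numerator of a
  bound \<open>_ / (k + 1)\<^sup>2\<close>, on the disagreement and on the distance to the exact value at the mean
  iterate; a name ending in \<open>bound\<close> denotes a bound for all times. The summand \<open>1\<close> in \<open>step_matrix_bound\<close> only
  keeps it positive.
\<close>

definition g_spread :: real where "g_spread = 2 * (spread g0 + 2 * real CARD('n) * (2 * L1 * D))"
definition g_bound :: real where "g_bound = (\<Sum>i\<in>UNIV. norm (g0 i)) + 2 * L1 * D + g_spread"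
definition s_bound :: real where "s_bound = sqrt (M * g_bound) / M"
definition x_spread :: real where "x_spread = 2 * (spread x0 + 2 * real CARD('n) * s_bound)"
definition g_err :: real where "g_err = g_spread + L1 * x_spread"
definition H_spread :: real where
  "H_spread = 2 * (spread H0 + 2 * real CARD('n) * ((real CARD('d))\<^sup>2 * (2 * L2 * D)))"
definition H_bound :: real where
  "H_bound = (\<Sum>i\<in>UNIV. norm (H0 i)) + (real CARD('d))\<^sup>2 * (2 * L2 * D) + H_spread"
definition H_err :: real where "H_err = H_spread + (real CARD('d))\<^sup>2 * (L2 * x_spread)"
definition step_matrix_bound :: real where
  "step_matrix_bound = 1 + H_bound + (sqrt (M * g_bound) + H_err) * norm (mat 1 :: real^'d^'d)"

lemma g_bound_nonneg: "0 \<le> g_bound" and g_spread_nonneg: "0 \<le> g_spread"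
  using L1_nonneg D_pos by (simp_all add: g_bound_def g_spread_def spread_nonneg sum_nonneg)

lemma s_bound_nonneg: "0 \<le> s_bound"
  using g_bound_nonneg M_pos by (simp add: s_bound_def)

lemma x_spread_nonneg: "0 \<le> x_spread"
  using s_bound_nonneg by (simp add: x_spread_def spread_nonneg)

lemma H_spread_nonneg: "0 \<le> H_spread" and H_bound_nonneg: "0 \<le> H_bound"
  using L2_nonneg D_pos by (simp_all add: H_bound_def H_spread_def spread_nonneg sum_nonneg)

lemma g_err_nonneg: "0 \<le> g_err" and H_err_nonneg: "0 \<le> H_err"
  using L1_nonneg L2_nonneg x_spread_nonneg g_spread_nonneg H_spread_nonneg
  by (simp_all add: g_err_def H_err_def)

lemma step_matrix_bound_ge_1: "1 \<le> step_matrix_bound"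
  using H_bound_nonneg H_err_nonneg g_bound_nonneg M_pos by (simp add: step_matrix_bound_def)

lemma div_square_le: "0 \<le> c \<Longrightarrow> c / (real k + 1)\<^sup>2 \<le> c"
  using one_le_power[of "real k + 1" 2] mult_left_mono[of 1 "(real k + 1)\<^sup>2" c]
  by (simp add: divide_le_eq)

lemma iterates_dist: "norm (run_x r k i - run_x r l i) \<le> 2 * D"
proof -
  obtain y where "\<And>k i. norm (run_x r k i - y) \<le> D"
    using bounded unfolding bounded_iterates_def by blast
  then have "dist (run_x r k i) y \<le> D" "dist (run_x r l i) y \<le> D" by (simp_all add: dist_norm)
  then show ?thesis
    using dist_triangle2[of "run_x r k i" "run_x r l i" y] by (simp add: dist_norm)
qed

lemma grad_diff_le: "norm (gradient (f i) (run_x r k i) - gradient (f i) (run_x r l i)) \<le> 2 * L1 * D"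
  using grad_lip[of i "run_x r k i" "run_x r l i"]
    mult_left_mono[OF iterates_dist[of k i l] L1_nonneg] by simp

lemma hess_diff_le:
  "norm (hessian (f i) (run_x r k i) - hessian (f i) (run_x r l i)) \<le> (real CARD('d))\<^sup>2 * (2 * L2 * D)"
proof -
  have "(real CARD('d))\<^sup>2 * (L2 * norm (run_x r k i - run_x r l i)) \<le> (real CARD('d))\<^sup>2 * (L2 * (2 * D))"
    by (intro mult_left_mono iterates_dist L2_nonneg) simp
  also have "L2 * (2 * D) = 2 * L2 * D" by simp
  finally show ?thesis
    by (rule order_trans[OF hess_lip_norm])
qed

text \<open>
  The pattern common to points, gradients and Hessians: mix, add a bounded increment, mix again.
\<close>

lemma spread_decay:
  fixes a e :: "nat \<Rightarrow> 'n \<Rightarrow> 'v::euclidean_space"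
  assumes step: "\<And>k. a (Suc k) = mix W (t k) (\<lambda>j. mix W (\<tau> k) (a k) j + e k j)"
    and e: "\<And>k j. norm (e k j) \<le> b"
  shows "spread (a k) \<le> 2 * (spread (a 0) + 2 * real CARD('n) * b) / (real k + 1)\<^sup>2"
proof (rule perturbed_contraction_decay[where \<epsilon> = "\<lambda>k. contraction_factor W ^ t k"])
  have "0 \<le> b" using e norm_ge_zero order_trans by blast
  then show "0 \<le> 2 * real CARD('n) * b" by simp
  fix k
  have "spread (a (Suc k)) \<le> contraction_factor W ^ t k * spread (\<lambda>j. mix W (\<tau> k) (a k) j + e k j)"
    unfolding step by (rule spread_mix[OF mixing])
  also have "\<dots> \<le> contraction_factor W ^ t k * (spread (a k) + 2 * real CARD('n) * b)"
    using spread_mix_le[OF mixing] spread_le[OF e]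
    by (intro mult_left_mono order_trans[OF spread_add_le] add_mono)
      (simp_all add: contraction_factor_def spectral_norm_nonneg)
  finally show "spread (a (Suc k))
    \<le> contraction_factor W ^ t k * (spread (a k) + 2 * real CARD('n) * b)" .
qed (auto simp: decay spread_nonneg)

lemma spread_tld_g: "spread (tld_g r k) \<le> g_spread / (real k + 1)\<^sup>2"
proof -
  have "spread (run_g r k) \<le> g_spread / (real k + 1)\<^sup>2"
    unfolding g_spread_def unfolding init(2)[symmetric]
    by (rule spread_decay[where e = "\<lambda>k j. gradient (f j) (run_x r (Suc k) j) - gradient (f j) (run_x r k j)"])
      (simp_all only: run_g_Suc tld_g grad_diff_le)
  then show ?thesis
    unfolding tld_g using spread_mix_le[OF mixing] order_trans by blast
qed

lemma spread_tld_H: "spread (tld_H r k) \<le> H_spread / (real k + 1)\<^sup>2"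
proof -
  have "spread (run_H r k) \<le> H_spread / (real k + 1)\<^sup>2"
    unfolding H_spread_def unfolding init(3)[symmetric]
    by (rule spread_decay[where e = "\<lambda>k j. hessian (f j) (run_x r (Suc k) j) - hessian (f j) (run_x r k j)"])
      (simp_all only: run_H_Suc tld_H hess_diff_le)
  then show ?thesis
    unfolding tld_H using spread_mix_le[OF mixing] order_trans by blast
qed

lemma norm_le_avg_plus_spread: "norm (v i) \<le> norm (avg v) + spread v"
  using norm_triangle_sub[of "v i" "avg v"] norm_diff_avg_le_spread[of v i] by linarith

lemma norm_tld_g: "norm (tld_g r k i) \<le> g_bound"
proof -
  have "norm (gradient (f j) (run_x r k j)) \<le> (\<Sum>i\<in>UNIV. norm (g0 i)) + 2 * L1 * D" for j
  proof -
    have "gradient (f j) (run_x r 0 j) = g0 j"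
      using run init unfolding disgrem_def by simp
    moreover have "norm (g0 j) \<le> (\<Sum>i\<in>UNIV. norm (g0 i))"
      by (rule member_le_sum) auto
    ultimately show ?thesis
      using norm_triangle_sub[of "gradient (f j) (run_x r k j)" "gradient (f j) (run_x r 0 j)"]
        grad_diff_le[of j k 0] by simp
  qed
  then have "norm (avg (tld_g r k)) \<le> (\<Sum>i\<in>UNIV. norm (g0 i)) + 2 * L1 * D"
    unfolding avg_tld_g by (rule norm_avg_bound)
  then show ?thesis
    using norm_le_avg_plus_spread[of "tld_g r k" i] spread_tld_g[of k]
      div_square_le[OF g_spread_nonneg, of k] by (simp add: g_bound_def)
qed

lemma norm_tld_H: "norm (tld_H r k i) \<le> H_bound"
proof -
  have "norm (hessian (f j) (run_x r k j)) \<le> (\<Sum>i\<in>UNIV. norm (H0 i)) + (real CARD('d))\<^sup>2 * (2 * L2 * D)" for j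
  proof -
    have "hessian (f j) (run_x r 0 j) = H0 j"
      using run init unfolding disgrem_def by simp
    moreover have "norm (H0 j) \<le> (\<Sum>i\<in>UNIV. norm (H0 i))"
      by (rule member_le_sum) auto
    ultimately show ?thesis
      using norm_triangle_sub[of "hessian (f j) (run_x r k j)" "hessian (f j) (run_x r 0 j)"]
        hess_diff_le[of j k 0] by simp
  qed
  then have "norm (avg (tld_H r k)) \<le> (\<Sum>i\<in>UNIV. norm (H0 i)) + (real CARD('d))\<^sup>2 * (2 * L2 * D)"
    unfolding avg_tld_H by (rule norm_avg_bound)
  then show ?thesis
    using norm_le_avg_plus_spread[of "tld_H r k" i] spread_tld_H[of k]
      div_square_le[OF H_spread_nonneg, of k] by (simp add: H_bound_def)
qed

definition step_matrix :: "nat \<Rightarrow> 'n \<Rightarrow> real^'d^'d" where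
  "step_matrix k i = tld_H r k i + (lam M r k i + del r k i) *\<^sub>R mat 1"

lemma step_matrix_apply: "step_matrix k i *v v = tld_H r k i *v v + (lam M r k i + del r k i) *\<^sub>R v"
  by (simp add: step_matrix_def matrix_vector_mult_add_rdistrib scaleR_matrix_vector_assoc[symmetric])

lemma step_matrix_step: "step_matrix k i *v run_s r k i = - tld_g r k i"
proof (cases "tld_g r k i = 0")
  case True
  moreover from this have "run_s r k i = 0" using run unfolding disgrem_def by simp
  ultimately show ?thesis by simp
next
  case False
  then show ?thesis using run unfolding disgrem_def step_matrix_def by metis
qed

lemma step_matrix_symmetric: "transpose (step_matrix k i) = step_matrix k i"
  by (rule symmetric_matrixI)
    (simp add: step_matrix_apply inner_add_right symmetric_matrix_inner[OF tld_H_symmetric] inner_commute)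

lemma step_matrix_ge_lam: "lam M r k i * (norm v)\<^sup>2 \<le> v \<bullet> (step_matrix k i *v v)"
  using min_eigenvalue_shift_psd[OF tld_H_symmetric, of v k i]
  by (simp add: step_matrix_apply inner_add_right power2_norm_eq_inner del_def distrib_right)

lemma lam_nonneg: "0 \<le> lam M r k i"
  using M_pos by (simp add: lam_def)

lemma step_matrix_psd: "0 \<le> v \<bullet> (step_matrix k i *v v)"
  using step_matrix_ge_lam[of k i v] lam_nonneg[of k i] by (meson order_trans mult_nonneg_nonneg zero_le_power2)

lemma lam_le: "lam M r k i \<le> sqrt (M * g_bound)"
  using M_pos norm_tld_g[of k i] by (simp add: lam_def)

text \<open>
  Testing \<open>B s = - g\<close> with \<open>s\<close> gives \<open>\<lambda> |s| \<le> |g|\<close>, and \<open>M |g| = \<lambda>\<^sup>2\<close>. This is where the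
  square-root regularisation is needed: the step is so short that the cubic Taylor error is at most
  \<open>\<lambda> |s|\<^sup>2\<close>. For \<open>\<lambda> = 0\<close> the gradient vanishes and the step is \<open>0\<close> by definition.
\<close>

lemma norm_step_le_lam: "M * norm (run_s r k i) \<le> lam M r k i"
proof (cases "tld_g r k i = 0")
  case True
  then show ?thesis using run lam_nonneg[of k i] by (simp add: disgrem_def)
next
  case False
  let ?s = "run_s r k i" and ?l = "lam M r k i"
  have l: "0 < ?l" using False M_pos by (simp add: lam_def)
  have "?s \<noteq> 0" using False step_matrix_step[of k i] by auto
  have "?l * (norm ?s)\<^sup>2 \<le> - (?s \<bullet> tld_g r k i)"
    using step_matrix_ge_lam[of k i ?s] by (simp add: step_matrix_step)
  also have "\<dots> \<le> norm ?s * norm (tld_g r k i)"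
    using Cauchy_Schwarz_ineq2[of ?s "tld_g r k i"] by linarith
  finally have "norm ?s * (?l * norm ?s) \<le> norm ?s * norm (tld_g r k i)"
    by (simp add: power2_eq_square mult_ac)
  then have "?l * norm ?s \<le> norm (tld_g r k i)"
    using \<open>?s \<noteq> 0\<close> by simp
  then have "M * (?l * norm ?s) \<le> M * norm (tld_g r k i)"
    using M_pos by simp
  also have "\<dots> = ?l * ?l"
    using M_pos by (simp add: lam_def)
  finally have "?l * (M * norm ?s) \<le> ?l * ?l" by (simp add: mult_ac)
  then show ?thesis using l by simp
qed

lemma norm_step: "norm (run_s r k i) \<le> s_bound"
  using norm_step_le_lam[of k i] lam_le[of k i] M_pos by (simp add: s_bound_def field_simps)

lemma spread_x: "spread (run_x r k) \<le> x_spread / (real k + 1)\<^sup>2"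
  unfolding x_spread_def unfolding init(1)[symmetric]
  by (rule spread_decay[where e = "run_s r"]) (simp_all only: run_x_Suc tld_x norm_step)

lemma dist_xbar: "norm (run_x r k i - xbar r k) \<le> x_spread / (real k + 1)\<^sup>2"
  using norm_diff_avg_le_spread[of "run_x r k" i] spread_x[of k] by (simp add: xbar_def)

lemma tld_g_err: "norm (tld_g r k i - gradF (xbar r k)) \<le> g_err / (real k + 1)\<^sup>2"
proof -
  have "norm (avg (tld_g r k) - gradF (xbar r k)) \<le> L1 * (x_spread / (real k + 1)\<^sup>2)"
    unfolding avg_tld_g gradF_def avg_diff[symmetric]
    by (rule norm_avg_bound)
      (rule order_trans[OF grad_lip mult_left_mono[OF dist_xbar L1_nonneg]])
  moreover have "norm (tld_g r k i - avg (tld_g r k)) \<le> g_spread / (real k + 1)\<^sup>2"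
    using norm_diff_avg_le_spread spread_tld_g order_trans by blast
  ultimately show ?thesis
    using norm_triangle_ineq[of "tld_g r k i - avg (tld_g r k)" "avg (tld_g r k) - gradF (xbar r k)"]
    by (simp add: g_err_def add_divide_distrib)
qed

lemma tld_H_err: "norm (tld_H r k i - hessF (xbar r k)) \<le> H_err / (real k + 1)\<^sup>2"
proof -
  have "norm (avg (tld_H r k) - hessF (xbar r k)) \<le> (real CARD('d))\<^sup>2 * (L2 * (x_spread / (real k + 1)\<^sup>2))"
    unfolding avg_tld_H hessF_def avg_diff[symmetric]
    by (rule norm_avg_bound)
      (rule order_trans[OF hess_lip_norm mult_left_mono[OF mult_left_mono[OF dist_xbar L2_nonneg]]], simp)
  moreover have "norm (tld_H r k i - avg (tld_H r k)) \<le> H_spread / (real k + 1)\<^sup>2"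
    using norm_diff_avg_le_spread spread_tld_H order_trans by blast
  ultimately show ?thesis
    using norm_triangle_ineq[of "tld_H r k i - avg (tld_H r k)" "avg (tld_H r k) - hessF (xbar r k)"]
    by (simp add: H_err_def add_divide_distrib)
qed

lemma del_nonneg: "0 \<le> del r k i"
  by (simp add: del_def)

lemma del_le: "del r k i \<le> H_err / (real k + 1)\<^sup>2"
  unfolding del_def
  using min_eigenvalue_shift_le[OF tld_H_symmetric hessF_psd, of k i "xbar r k"] tld_H_err[of k i]
  by linarith

lemma norm_step_matrix: "norm (step_matrix k i) \<le> step_matrix_bound"
proof -
  have "norm (step_matrix k i) \<le> norm (tld_H r k i) + (lam M r k i + del r k i) * norm (mat 1 :: real^'d^'d)"
    unfolding step_matrix_def using norm_triangle_ineq[of "tld_H r k i"] lam_nonneg[of k i] del_nonneg[of k i]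
    by (metis abs_of_nonneg add_nonneg_nonneg norm_scaleR)
  also have "\<dots> \<le> H_bound + (sqrt (M * g_bound) + H_err) * norm (mat 1 :: real^'d^'d)"
    using lam_le[of k i] del_le[of k i] div_square_le[OF H_err_nonneg, of k]
    by (intro add_mono norm_tld_H mult_right_mono) auto
  finally show ?thesis by (simp add: step_matrix_bound_def)
qed

end

section \<open>Descent and the hitting time\<close>

text \<open>
  The first half of the \<open>n\<close> steps brings the gap \<open>\<phi>\<close> down to \<open>O(1 / n)\<close>, since the decrease is at
  least \<open>c (\<phi> / D)\<^sup>2\<close>. Each step of the second half uses up at least \<open>c e\<^sup>2\<close> of what is left, so
  \<open>n e\<^sup>2\<close> is at most of order \<open>1 / n\<close>.
\<close>

lemma sublinear_rate:
  fixes \<phi> \<gamma> :: "nat \<Rightarrow> real"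
  assumes c: "c > 0" and D: "D > 0" and e: "e > 0"
    and descent: "\<And>j. j < n \<Longrightarrow> \<phi> (Suc j) \<le> \<phi> j - c * (\<gamma> j)\<^sup>2"
    and nonneg: "\<And>j. 0 \<le> \<phi> j" and gap: "\<And>j. \<phi> j \<le> D * \<gamma> j"
    and large: "\<And>j. j < n \<Longrightarrow> e \<le> \<gamma> j"
  shows "real n \<le> 2 * (D / (c * e)) + 1"
proof -
  define m where "m = n div 2"
  have phase1: "real j * (c * \<phi> j / D\<^sup>2) \<le> 1" if "j \<le> n" for j
    using that
  proof (induction j)
    case (Suc j)
    define y where "y = c * \<phi> j / D\<^sup>2"
    have jy: "real j * y \<le> 1" using Suc by (simp add: y_def)
    have y0: "0 \<le> y" using c nonneg[of j] by (simp add: y_def)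
    have "(\<phi> j / D)\<^sup>2 \<le> (\<gamma> j)\<^sup>2"
      using gap[of j] nonneg[of j] D by (intro power_mono) (auto simp: field_simps)
    then have "c * (\<phi> j / D)\<^sup>2 \<le> c * (\<gamma> j)\<^sup>2"
      using c by (intro mult_left_mono) auto
    then have "\<phi> (Suc j) \<le> \<phi> j - c * (\<phi> j / D)\<^sup>2"
      using descent[of j] Suc.prems by linarith
    then have "c / D\<^sup>2 * \<phi> (Suc j) \<le> c / D\<^sup>2 * (\<phi> j - c * (\<phi> j / D)\<^sup>2)"
      using c by (intro mult_left_mono) auto
    also have "\<dots> = y - y\<^sup>2"
      using D by (simp add: y_def field_simps power2_eq_square)
    finally have next_le: "c * \<phi> (Suc j) / D\<^sup>2 \<le> y - y\<^sup>2" by simp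
    have "0 \<le> c * \<phi> (Suc j) / D\<^sup>2" using c nonneg by simp
    then have "0 \<le> y * (1 - y)" using next_le by (simp add: power2_eq_square algebra_simps)
    then have y1: "y \<le> 1" using y0 by (auto simp: zero_le_mult_iff)
    have "real (Suc j) * (c * \<phi> (Suc j) / D\<^sup>2) \<le> (real j + 1) * (y - y\<^sup>2)"
      using mult_left_mono[OF next_le, of "real j + 1"] by (simp add: add.commute)
    also have "\<dots> = (real j * y) * (1 - y) + y * (1 - y)"
      by (simp add: power2_eq_square algebra_simps)
    also have "\<dots> \<le> 1 * (1 - y) + y * (1 - y)"
      using jy y1 by (intro add_right_mono mult_right_mono) auto
    also have "\<dots> = 1 - y * y" by (simp add: algebra_simps)
    also have "\<dots> \<le> 1" by simp
    finally show ?case .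
  qed simp
  have phase2: "\<phi> (m + i) \<le> \<phi> m - real i * (c * e\<^sup>2)" if "m + i \<le> n" for i
    using that
  proof (induction i)
    case (Suc i)
    have "e\<^sup>2 \<le> (\<gamma> (m + i))\<^sup>2"
      using large[of "m + i"] Suc.prems e by (intro power_mono) auto
    then have "c * e\<^sup>2 \<le> c * (\<gamma> (m + i))\<^sup>2"
      using c by (intro mult_left_mono) auto
    then show ?case
      using descent[of "m + i"] Suc by (simp add: algebra_simps)
  qed simp
  have "real m * (c * e\<^sup>2) \<le> \<phi> m"
  proof -
    have "m + m \<le> n" unfolding m_def by linarith
    then show ?thesis
      using phase2[of m] nonneg[of "m + m"] by linarith
  qed
  then have "real m * (c * (real m * (c * e\<^sup>2)) / D\<^sup>2) \<le> real m * (c * \<phi> m / D\<^sup>2)"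
    using c by (intro mult_left_mono divide_right_mono) auto
  also have "\<dots> \<le> 1" by (rule phase1) (simp add: m_def)
  finally have "(real m * (c * e) / D)\<^sup>2 \<le> 1\<^sup>2"
    by (simp add: power2_eq_square field_simps)
  then have "real m * (c * e) / D \<le> 1"
    by (rule power2_le_imp_le) simp
  then have "real m \<le> D / (c * e)"
    using c e D by (simp add: field_simps)
  moreover have "real n \<le> 2 * real m + 1" unfolding m_def by linarith
  ultimately show ?thesis by linarith
qed

context disgrem_instance
begin

text \<open>
  After \<open>descent_start / \<epsilon>\<close> iterations the error of the gradients is at most half of a gradient norm
  above \<open>\<epsilon>\<close>, and \<open>noise\<close>, the error in the objective, at most half of the resulting decrease. The
  factor \<open>32\<close> in \<open>hit_const\<close> is twice the \<open>16\<close> of \<open>descent\<close>, as in \<open>sublinear_rate\<close>; the summand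
  \<open>4\<close> pays for rounding to integers.
\<close>

definition noise :: real where "noise = s_bound * g_err + s_bound\<^sup>2 * H_err"
definition descent_start :: real where "descent_start = 1 + 2 * g_err + 16 * step_matrix_bound * noise"
definition hit_const :: real where "hit_const = descent_start + 32 * step_matrix_bound * D + 4"

lemma noise_nonneg: "0 \<le> noise"
  using s_bound_nonneg g_err_nonneg H_err_nonneg by (simp add: noise_def)

text \<open>
  The Taylor expansion at the mean iterate along one agent's step, with the exact gradient and Hessian
  replaced by the tracked ones. The system turns the linear term into \<open>- s \<bullet> B s\<close>, of which the
  quadratic term gives back one half; the regularisation that is left over absorbs the cubic term.
\<close>

lemma agent_descent:
  "objective f (xbar r k + run_s r k i)
    \<le> objective f (xbar r k) - (norm (tld_g r k i))\<^sup>2 / (2 * step_matrix_bound) + noise / (real k + 1)\<^sup>2"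
proof -
  let ?x = "xbar r k" and ?s = "run_s r k i" and ?q = "(real k + 1)\<^sup>2"
  let ?B = "?s \<bullet> (step_matrix k i *v ?s)"
  have lin: "?s \<bullet> gradF ?x \<le> - ?B + norm ?s * (g_err / ?q)"
  proof -
    have "?s \<bullet> (gradF ?x - tld_g r k i) \<le> norm ?s * norm (gradF ?x - tld_g r k i)"
      by (rule norm_cauchy_schwarz)
    also have "\<dots> \<le> norm ?s * (g_err / ?q)"
      using tld_g_err[of k i] by (intro mult_left_mono) (auto simp: norm_minus_commute)
    finally show ?thesis by (simp add: step_matrix_step inner_diff_right)
  qed
  have quad: "?s \<bullet> (hessF ?x *v ?s)
      \<le> ?B - (lam M r k i + del r k i) * (norm ?s)\<^sup>2 + (H_err / ?q) * (norm ?s)\<^sup>2"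
  proof -
    have "\<bar>?s \<bullet> ((tld_H r k i - hessF ?x) *v ?s)\<bar> \<le> (H_err / ?q) * (norm ?s)\<^sup>2"
      by (intro order_trans[OF inner_matrix_vector_le] mult_right_mono tld_H_err) simp
    then show ?thesis
      by (simp add: step_matrix_apply matrix_vector_mult_diff_rdistrib inner_diff_right inner_add_right
          power2_norm_eq_inner)
  qed
  have cubic: "L2 * norm ?s ^ 3 \<le> lam M r k i * (norm ?s)\<^sup>2"
  proof -
    have "L2 * norm ?s \<le> lam M r k i"
      using norm_step_le_lam[of k i] mult_right_mono[OF L2_le_M, of "norm ?s"] by simp
    then have "(L2 * norm ?s) * (norm ?s)\<^sup>2 \<le> lam M r k i * (norm ?s)\<^sup>2"
      by (rule mult_right_mono) simp
    then show ?thesis by (simp add: power2_eq_square power3_eq_cube mult_ac)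
  qed
  have main: "(norm (tld_g r k i))\<^sup>2 / (2 * step_matrix_bound) \<le> ?B / 2"
  proof -
    have "(norm (tld_g r k i))\<^sup>2 \<le> norm (step_matrix k i) * ?B"
      using psd_norm_le[OF step_matrix_symmetric step_matrix_psd, of k i ?s] by (simp add: step_matrix_step)
    also have "\<dots> \<le> step_matrix_bound * ?B"
      by (intro mult_right_mono norm_step_matrix step_matrix_psd)
    finally show ?thesis
      using step_matrix_bound_ge_1 by (simp add: field_simps)
  qed
  have err: "norm ?s * (g_err / ?q) + (H_err / ?q) * (norm ?s)\<^sup>2 \<le> noise / ?q"
  proof -
    have "norm ?s * (g_err / ?q) \<le> s_bound * (g_err / ?q)"
      using g_err_nonneg by (intro mult_right_mono norm_step) auto
    moreover have "(H_err / ?q) * (norm ?s)\<^sup>2 \<le> (H_err / ?q) * s_bound\<^sup>2"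
      using H_err_nonneg by (intro mult_left_mono power_mono norm_step) auto
    ultimately show ?thesis by (simp add: noise_def add_divide_distrib mult.commute)
  qed
  have pos: "0 \<le> del r k i * (norm ?s)\<^sup>2" "0 \<le> (H_err / ?q) * (norm ?s)\<^sup>2"
    using del_nonneg[of k i] H_err_nonneg by simp_all
  show ?thesis
    using obj.cubic_upper_bound[OF hessF_lip, of ?x ?s] lin quad cubic main err pos
    unfolding distrib_right by linarith
qed

lemma objective_gap_nonneg:
  assumes "is_arg_min (objective f) (\<lambda>_. True) y"
  shows "0 \<le> objective f x - objective f y"
  using assms by (simp add: is_arg_min_linorder)

lemma objective_gap_le:
  assumes "norm (xbar r k - y) \<le> D"
  shows "objective f (xbar r k) - objective f y \<le> D * norm (gradF (xbar r k))"
proof -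
  have "objective f (xbar r k) - objective f y \<le> (xbar r k - y) \<bullet> gradF (xbar r k)"
    using obj.above_tangent[OF convex_objective, of "xbar r k" y] by (simp add: inner_diff_left)
  also have "\<dots> \<le> norm (xbar r k - y) * norm (gradF (xbar r k))"
    by (rule norm_cauchy_schwarz)
  also have "\<dots> \<le> D * norm (gradF (xbar r k))"
    using assms by (intro mult_right_mono) auto
  finally show ?thesis .
qed

lemma descent:
  assumes e: "0 < e" "e \<le> 1" and k: "descent_start / e \<le> real k"
    and large: "e \<le> norm (gradF (xbar r k))"
  shows "objective f (xbar r (Suc k))
    \<le> objective f (xbar r k) - 1 / (16 * step_matrix_bound) * (norm (gradF (xbar r k)))\<^sup>2"
proof -
  let ?F = "objective f (xbar r k)" and ?\<gamma> = "norm (gradF (xbar r k))" and ?q = "(real k + 1)\<^sup>2"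
  have Bb: "0 < step_matrix_bound" using step_matrix_bound_ge_1 by simp
  have start: "1 \<le> descent_start" "2 * g_err \<le> descent_start" "16 * step_matrix_bound * noise \<le> descent_start"
    using g_err_nonneg noise_nonneg Bb by (simp_all add: descent_start_def)
  have "descent_start \<le> e * (real k + 1)"
    using k e by (simp add: field_simps)
  moreover from this have "1 * descent_start \<le> (e * (real k + 1)) * (e * (real k + 1))"
    using start by (intro mult_mono) auto
  ultimately have q: "descent_start \<le> e\<^sup>2 * ?q"
    by (simp add: power2_eq_square mult_ac)
  have e2: "e\<^sup>2 \<le> e" using e by (simp add: power2_eq_square)
  have "g_err / ?q \<le> e\<^sup>2 / 2"
    using q start by (simp add: field_simps)
  then have err: "g_err / ?q \<le> ?\<gamma> / 2" using e2 large by linarith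
  have "noise / ?q \<le> e\<^sup>2 / (16 * step_matrix_bound)"
    using q start Bb by (simp add: field_simps)
  also have "\<dots> \<le> ?\<gamma>\<^sup>2 / (16 * step_matrix_bound)"
    using large e Bb by (intro divide_right_mono power_mono) auto
  finally have noise: "noise / ?q \<le> ?\<gamma>\<^sup>2 / (16 * step_matrix_bound)" .
  have agent: "objective f (xbar r k + run_s r k i) \<le> ?F - ?\<gamma>\<^sup>2 / (16 * step_matrix_bound)" for i
  proof -
    have "?\<gamma> / 2 \<le> norm (tld_g r k i)"
      using tld_g_err[of k i] err norm_triangle_sub[of "gradF (xbar r k)" "tld_g r k i"]
      unfolding norm_minus_commute[of "gradF (xbar r k)" "tld_g r k i"] by linarith
    then have "(?\<gamma> / 2)\<^sup>2 \<le> (norm (tld_g r k i))\<^sup>2"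
      by (intro power_mono) auto
    then have "(?\<gamma> / 2)\<^sup>2 / (2 * step_matrix_bound) \<le> (norm (tld_g r k i))\<^sup>2 / (2 * step_matrix_bound)"
      using Bb by (intro divide_right_mono) auto
    moreover have "(?\<gamma> / 2)\<^sup>2 / (2 * step_matrix_bound) = ?\<gamma>\<^sup>2 / (16 * step_matrix_bound) + ?\<gamma>\<^sup>2 / (16 * step_matrix_bound)"
      using Bb by (simp add: field_simps power2_eq_square)
    ultimately show ?thesis
      using agent_descent[of k i] noise by linarith
  qed
  have "xbar r (Suc k) = avg (\<lambda>i. xbar r k + run_s r k i)"
    by (simp add: xbar_Suc sbar_def avg_add)
  then have "objective f (xbar r (Suc k)) \<le> avg (\<lambda>i. objective f (xbar r k + run_s r k i))"
    by (simp add: objective_avg_le)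
  also have "\<dots> \<le> avg (\<lambda>i::'n. ?F - ?\<gamma>\<^sup>2 / (16 * step_matrix_bound))"
    by (intro avg_mono agent)
  finally show ?thesis by simp
qed

lemma grad_norm_eq: "grad_norm f r k = norm (gradF (xbar r k))"
  by (simp add: grad_norm_def gradient_objective)

lemma hit:
  assumes e: "0 < e" "e \<le> 1"
  shows "\<exists>k. real k \<le> hit_const / e \<and> grad_norm f r k \<le> e"
proof (rule ccontr)
  assume "\<not> ?thesis"
  then have above: "e < norm (gradF (xbar r k))" if "real k \<le> hit_const / e" for k
    using that by (force simp: grad_norm_eq)
  define c where "c = 1 / (16 * step_matrix_bound)"
  define k0 where "k0 = nat \<lceil>descent_start / e\<rceil>"
  define n where "n = nat \<lceil>2 * (D / (c * e))\<rceil> + 2"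
  have Bb: "0 < step_matrix_bound" using step_matrix_bound_ge_1 by simp
  then have c: "c > 0" by (simp add: c_def)
  have start: "0 \<le> descent_start"
    using g_err_nonneg noise_nonneg Bb by (simp add: descent_start_def)
  have k0: "descent_start / e \<le> real k0" "real k0 \<le> descent_start / e + 1"
    using start e unfolding k0_def by (auto simp: real_nat_ceiling_ge)
  have "0 \<le> 2 * (D / (c * e))" using D_pos c e by simp
  then have n: "2 * (D / (c * e)) + 1 < real n" "real n \<le> 2 * (D / (c * e)) + 3"
    unfolding n_def by (auto simp: real_nat_ceiling_ge intro: le_less_trans[OF real_nat_ceiling_ge]) linarith+
  have "2 * (D / (c * e)) = 32 * step_matrix_bound * D / e"
    using Bb by (simp add: c_def field_simps)
  moreover have "4 \<le> 4 / e" using e by (simp add: field_simps)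
  moreover have "hit_const / e = descent_start / e + 32 * step_matrix_bound * D / e + 4 / e"
    by (simp add: hit_const_def add_divide_distrib)
  ultimately have fits: "real k0 + real n \<le> hit_const / e"
    using k0 n by linarith
  obtain y where y: "is_arg_min (objective f) (\<lambda>_. True) y" "\<And>k. norm (xbar r k - y) \<le> D"
    using bounded unfolding bounded_iterates_def by blast
  have "real n \<le> 2 * (D / (c * e)) + 1"
  proof (rule sublinear_rate[where \<phi> = "\<lambda>j. objective f (xbar r (k0 + j)) - objective f y"
        and \<gamma> = "\<lambda>j. norm (gradF (xbar r (k0 + j)))"])
    fix j assume "j < n"
    then have j: "e \<le> norm (gradF (xbar r (k0 + j)))"
      using fits by (intro less_imp_le above) simp
    then show "e \<le> norm (gradF (xbar r (k0 + j)))" .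
    show "objective f (xbar r (k0 + Suc j)) - objective f y
        \<le> objective f (xbar r (k0 + j)) - objective f y - c * (norm (gradF (xbar r (k0 + j))))\<^sup>2"
      using descent[OF e _ j] k0 by (simp add: c_def)
  qed (use c D_pos e y objective_gap_nonneg objective_gap_le in auto)
  with n show False by simp
qed

section \<open>Existence of the burn-in index\<close>

lemma eventually_decayed:
  assumes "0 < e"
  shows "\<forall>\<^sub>F k in sequentially. c / (real k + 1)\<^sup>2 \<le> e"
proof -
  have "(\<lambda>k. c / (real k + 1)\<^sup>2) \<longlonglongrightarrow> 0"
    by real_asymp
  then have "\<forall>\<^sub>F k in sequentially. c / (real k + 1)\<^sup>2 < e"
    using assms by (rule order_tendstoD)
  then show ?thesis by (rule eventually_mono) simp
qed

text \<open>
  The reference matrix is exactly the average of the agents' matrices, because \<open>lambar\<close> averages the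
  same shifts. It therefore inherits their bounds, and \<open>A_ref sbar + gbar\<close> is the average of the
  \<open>(A_ref - step_matrix i) s_i\<close>, without any error from the gradients.
\<close>

lemma A_ref_eq: "A_ref M r k = avg (step_matrix k)"
  using avg_linear[of "\<lambda>c. c *\<^sub>R (mat 1 :: real^'d^'d)" "\<lambda>i. lam M r k i + del r k i"]
  by (simp add: A_ref_def step_matrix_def[abs_def] Hbar_def lambar_def avg_add linear_iff scaleR_left_distrib)

lemma norm_A_ref: "norm (A_ref M r k) \<le> step_matrix_bound"
  unfolding A_ref_eq by (rule norm_avg_bound) (rule norm_step_matrix)

lemma dispersion_le: "dispersion r k \<le> x_spread / (real k + 1)\<^sup>2"
proof -
  have "avg (\<lambda>i. (norm (run_x r k i - xbar r k))\<^sup>2) \<le> avg (\<lambda>i::'n. (x_spread / (real k + 1)\<^sup>2)\<^sup>2)"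
    by (intro avg_mono power_mono dist_xbar) simp
  then have "dispersion r k \<le> sqrt ((x_spread / (real k + 1)\<^sup>2)\<^sup>2)"
    unfolding dispersion_def by (intro real_sqrt_le_mono) (simp only: avg_const)
  also have "\<dots> = x_spread / (real k + 1)\<^sup>2"
    using x_spread_nonneg by (intro real_sqrt_unique) auto
  finally show ?thesis .
qed

lemma Delta_g_le: "Delta_g r k \<le> g_spread / (real k + 1)\<^sup>2"
proof -
  have "Delta_g r k \<le> avg (\<lambda>i::'n. g_spread / (real k + 1)\<^sup>2)"
    unfolding Delta_g_def gbar_def
    by (intro avg_mono order_trans[OF norm_diff_avg_le_spread spread_tld_g])
  then show ?thesis by simp
qed

lemma Delta_H_le: "Delta_H r k \<le> H_spread / (real k + 1)\<^sup>2"
proof -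
  have "Delta_H r k \<le> avg (\<lambda>i::'n. H_spread / (real k + 1)\<^sup>2)"
    unfolding Delta_H_def Hbar_def
    by (intro avg_mono order_trans[OF spectral_norm_le_norm]
        order_trans[OF norm_diff_avg_le_spread spread_tld_H])
  then show ?thesis by simp
qed

lemma delbar_le: "delbar r k \<le> H_err / (real k + 1)\<^sup>2"
  using avg_mono[of "del r k" "\<lambda>_. H_err / (real k + 1)\<^sup>2"] del_le by (simp add: delbar_def)

text \<open>
  Bounds, up to the factor \<open>1 / (k + 1)\<^sup>2\<close>, how far an agent's matrix is from the one built from the
  exact gradient and Hessian at the mean iterate. The square root in \<open>\<lambda>\<close> is Lipschitz with constant
  \<open>M / l\<close> on the gradients for which \<open>\<lambda> \<ge> l\<close>, so a lower bound on the gradient is essential here.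
\<close>

definition sensitivity :: "real \<Rightarrow> real" where
  "sensitivity l = H_err + (M * g_err / l + H_err) * norm (mat 1 :: real^'d^'d)"

lemma
  assumes e: "0 < e" and k: "g_err / (real k + 1)\<^sup>2 \<le> e / 2"
    and large: "e \<le> norm (gradF (xbar r k))"
  defines "l \<equiv> sqrt (M * (e / 2))"
  shows lam_lower: "l \<le> lam M r k i"
    and gbar_lower: "e / 2 \<le> norm (gbar r k)"
    and A_ref_sub_step_matrix: "norm (A_ref M r k - step_matrix k i) \<le> 2 * sensitivity l / (real k + 1)\<^sup>2"
proof -
  let ?q = "(real k + 1)\<^sup>2" and ?g = "gradF (xbar r k)" and ?m = "norm (mat 1 :: real^'d^'d)"
  have l: "0 < l" using e M_pos by (simp add: l_def)
  have lower: "e / 2 \<le> norm v" if "norm (v - ?g) \<le> g_err / ?q" for v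
    using that k large norm_triangle_sub[of ?g v] unfolding norm_minus_commute[of ?g v] by linarith
  show lam_ge: "l \<le> lam M r k i" for i
    unfolding l_def lam_def
    using lower[OF tld_g_err[of k i]] M_pos by (intro real_sqrt_le_mono mult_left_mono) auto
  have "gbar r k - ?g = avg (\<lambda>i. tld_g r k i - ?g)"
    by (simp add: gbar_def avg_diff)
  then have "norm (gbar r k - ?g) \<le> g_err / ?q"
    using norm_avg_bound[of "\<lambda>i. tld_g r k i - ?g"] tld_g_err by simp
  then show "e / 2 \<le> norm (gbar r k)" by (rule lower)
  define \<mu> where "\<mu> = sqrt (M * norm ?g)"
  have lam_err: "\<bar>lam M r k i - \<mu>\<bar> \<le> (M * g_err / l) / ?q" for i
  proof -
    have \<mu>: "0 \<le> \<mu>" using M_pos by (simp add: \<mu>_def)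
    have "(lam M r k i - \<mu>) * (lam M r k i + \<mu>) = M * norm (tld_g r k i) - M * norm ?g"
      using M_pos by (simp add: lam_def \<mu>_def algebra_simps)
    moreover have "\<bar>lam M r k i - \<mu>\<bar> * (lam M r k i + \<mu>) = \<bar>(lam M r k i - \<mu>) * (lam M r k i + \<mu>)\<bar>"
      using lam_nonneg[of k i] \<mu> by (simp add: abs_mult)
    ultimately have "\<bar>lam M r k i - \<mu>\<bar> * (lam M r k i + \<mu>) = M * \<bar>norm (tld_g r k i) - norm ?g\<bar>"
      using M_pos by (simp add: abs_mult right_diff_distrib[symmetric])
    also have "\<dots> \<le> M * (g_err / ?q)"
      using M_pos tld_g_err[of k i] norm_triangle_ineq3[of "tld_g r k i" ?g]
      by (intro mult_left_mono) auto
    finally have "\<bar>lam M r k i - \<mu>\<bar> * (lam M r k i + \<mu>) \<le> M * (g_err / ?q)" .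
    moreover have "\<bar>lam M r k i - \<mu>\<bar> * l \<le> \<bar>lam M r k i - \<mu>\<bar> * (lam M r k i + \<mu>)"
      using lam_ge[of i] \<mu> by (intro mult_left_mono) auto
    ultimately have "\<bar>lam M r k i - \<mu>\<bar> * l \<le> M * (g_err / ?q)" by linarith
    then have "\<bar>lam M r k i - \<mu>\<bar> \<le> M * (g_err / ?q) / l"
      by (subst pos_le_divide_eq[OF l])
    then show ?thesis by (simp add: mult_ac)
  qed
  \<comment> \<open>Distances to the common centre \<open>C\<close> also bound those to the average, up to a factor \<open>2\<close>.\<close>
  define C where "C = hessF (xbar r k) + \<mu> *\<^sub>R mat 1"
  have C: "norm (step_matrix k i - C) \<le> sensitivity l / ?q" for i
  proof -
    have "step_matrix k i - C = (tld_H r k i - hessF (xbar r k)) + (lam M r k i - \<mu> + del r k i) *\<^sub>R mat 1"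
      by (simp add: step_matrix_def C_def algebra_simps)
    then have "norm (step_matrix k i - C)
        \<le> norm (tld_H r k i - hessF (xbar r k)) + \<bar>lam M r k i - \<mu> + del r k i\<bar> * ?m"
      by (metis norm_scaleR norm_triangle_ineq)
    also have "\<dots> \<le> H_err / ?q + ((M * g_err / l) / ?q + H_err / ?q) * ?m"
      using lam_err[of i] del_le[of k i] del_nonneg[of k i]
      by (intro add_mono mult_right_mono tld_H_err) auto
    also have "\<dots> = sensitivity l / ?q"
      by (simp add: sensitivity_def add_divide_distrib distrib_right)
    finally show ?thesis .
  qed
  have "avg (step_matrix k) - C = avg (\<lambda>i. step_matrix k i - C)"
    by (simp add: avg_diff)
  then have "norm (avg (step_matrix k) - C) \<le> sensitivity l / ?q"
    using norm_avg_bound[of "\<lambda>i. step_matrix k i - C"] C by simp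
  then show "norm (A_ref M r k - step_matrix k i) \<le> 2 * sensitivity l / ?q"
    unfolding A_ref_eq using C[of i] norm_triangle_ineq4[of "avg (step_matrix k) - C" "step_matrix k i - C"] by simp
qed

lemma reference_step:
  assumes e: "0 < e" and k: "g_err / (real k + 1)\<^sup>2 \<le> e / 2"
    and large: "e \<le> norm (gradF (xbar r k))"
  defines "l \<equiv> sqrt (M * (e / 2))"
  defines "\<beta> \<equiv> 2 * sensitivity l * s_bound"
  assumes k': "\<beta> / (real k + 1)\<^sup>2 \<le> e / 4"
  shows "invertible (A_ref M r k)"
    and "l * norm (sbar r k - s_ref M r k) \<le> \<beta> / (real k + 1)\<^sup>2"
    and "e / 4 \<le> step_matrix_bound * norm (sbar r k)"
    and "l \<le> lambar M r k"
proof -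
  let ?A = "A_ref M r k" and ?q = "(real k + 1)\<^sup>2"
  have l: "0 < l" using e M_pos by (simp add: l_def)
  have lam: "l \<le> lam M r k i" for i
    unfolding l_def by (rule lam_lower[OF e k large])
  have coercive: "l * norm v \<le> norm (?A *v v)" for v
  proof -
    have "avg (\<lambda>i::'n. l * (norm v)\<^sup>2) \<le> avg (\<lambda>i. v \<bullet> (step_matrix k i *v v))"
      by (intro avg_mono order_trans[OF mult_right_mono[OF lam] step_matrix_ge_lam]) simp
    also have "\<dots> = v \<bullet> (?A *v v)"
      unfolding A_ref_eq
      by (rule avg_linear[symmetric])
        (auto intro!: linearI simp: matrix_vector_mult_add_rdistrib inner_add_right scaleR_matrix_vector_assoc[symmetric])
    also have "\<dots> \<le> norm v * norm (?A *v v)" by (rule norm_cauchy_schwarz)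
    finally have "norm v * (l * norm v) \<le> norm v * norm (?A *v v)"
      by (simp add: power2_eq_square mult_ac)
    then show ?thesis
      by (cases "v = 0") auto
  qed
  have ker: "v = 0" if "?A *v v = 0" for v
  proof -
    have "l * norm v \<le> 0" using coercive[of v] that by simp
    then show "v = 0" using l by (simp add: mult_le_0_iff)
  qed
  show inv: "invertible ?A"
    unfolding invertible_left_inverse matrix_left_invertible_ker using ker by blast
  have "?A ** matrix_inv ?A = mat 1"
    using inv unfolding invertible_def matrix_inv_def by (rule someI2_ex) simp
  then have ref: "?A *v s_ref M r k = - gbar r k"
    by (simp add: s_ref_def vec.neg matrix_vector_mul_assoc)
  have lin: "linear ((*v) ?A)" by simp
  define d where "d = avg (\<lambda>i. (?A - step_matrix k i) *v run_s r k i)"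
  have d: "?A *v sbar r k = d - gbar r k"
    unfolding sbar_def avg_linear[OF lin] d_def gbar_def
    by (simp add: matrix_vector_mult_diff_rdistrib step_matrix_step avg_add)
  have norm_d: "norm d \<le> \<beta> / ?q"
    unfolding d_def
  proof (rule norm_avg_bound)
    fix i
    have "norm ((?A - step_matrix k i) *v run_s r k i) \<le> norm (?A - step_matrix k i) * norm (run_s r k i)"
      by (rule norm_matrix_vector_le)
    also have "\<dots> \<le> (2 * sensitivity l / ?q) * s_bound"
    proof (rule mult_mono)
      show "norm (?A - step_matrix k i) \<le> 2 * sensitivity l / ?q"
        unfolding l_def by (rule A_ref_sub_step_matrix[OF e k large])
      then show "0 \<le> 2 * sensitivity l / ?q" using norm_ge_zero order_trans by blast
    qed (auto intro: norm_step)
    finally show "norm ((?A - step_matrix k i) *v run_s r k i) \<le> \<beta> / ?q" by (simp add: \<beta>_def)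
  qed
  have "?A *v (sbar r k - s_ref M r k) = d"
    by (simp add: matrix_vector_mult_diff_distrib d ref)
  then show "l * norm (sbar r k - s_ref M r k) \<le> \<beta> / ?q"
    using coercive[of "sbar r k - s_ref M r k"] norm_d by simp
  have "e / 4 \<le> norm (gbar r k) - norm d"
    using gbar_lower[OF e k large] norm_d k' by linarith
  also have "\<dots> \<le> norm (?A *v sbar r k)"
    unfolding d using norm_triangle_ineq2[of "gbar r k" d] by (simp add: norm_minus_commute)
  also have "\<dots> \<le> step_matrix_bound * norm (sbar r k)"
    by (intro order_trans[OF norm_matrix_vector_le] mult_right_mono norm_A_ref) simp
  finally show "e / 4 \<le> step_matrix_bound * norm (sbar r k)" .
  have "avg (\<lambda>i::'n. l) \<le> lambar M r k"
    unfolding lambar_def using lam del_nonneg by (intro avg_mono) (simp add: add_increasing2)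
  then show "l \<le> lambar M r k" by simp
qed

text \<open>
  By \<open>reference_step\<close>, for gradients above the accuracy the right-hand sides of the burn-in conditions
  are at least positive constants built from \<open>l\<close> and \<open>\<sigma>\<close>, while all left-hand sides decay. The factor
  \<open>1 / 96\<close> is \<open>\<eta> / 8\<close>.
\<close>

lemma burned_in_exists:
  assumes e: "0 < e"
  shows "\<exists>K. burned_in f L1 L2 M r e K"
proof -
  define l where "l = sqrt (M * (e / 2))"
  define \<beta> where "\<beta> = 2 * sensitivity l * s_bound"
  define \<sigma> where "\<sigma> = e / (4 * step_matrix_bound)"
  have pos: "0 < l" "0 < \<sigma>" "0 \<le> L1" "0 < step_matrix_bound"
    using e M_pos step_matrix_bound_ge_1 L1_nonneg by (simp_all add: l_def \<sigma>_def)
  have ep: "0 < e powr (3/2)" using e by simp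
  have "\<forall>\<^sub>F k in sequentially.
      g_err / (real k + 1)\<^sup>2 \<le> e / 2 \<and> \<beta> / (real k + 1)\<^sup>2 \<le> e / 4 \<and>
      \<beta> / (real k + 1)\<^sup>2 \<le> l * (1 / 96 * (l / (L1 + l)) * \<sigma>) \<and>
      L1 * x_spread / (real k + 1)\<^sup>2 \<le> 1 / 96 * l * \<sigma> \<and>
      L2 * x_spread / (real k + 1)\<^sup>2 \<le> 1 / 96 * l \<and>
      g_spread / (real k + 1)\<^sup>2 \<le> e\<^sup>2 \<and> H_spread / (real k + 1)\<^sup>2 \<le> e powr (3/2) \<and>
      x_spread / (real k + 1)\<^sup>2 \<le> e powr (3/2) \<and>
      H_err / (real k + 1)\<^sup>2 \<le> (1 + L2) * e powr (3/2)"
    using pos e ep L2_nonneg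
    by (intro eventually_conj eventually_decayed)
      (auto intro!: mult_pos_pos divide_pos_pos add_nonneg_pos)
  then obtain K where K: "\<And>k. k \<ge> K \<Longrightarrow>
      g_err / (real k + 1)\<^sup>2 \<le> e / 2 \<and> \<beta> / (real k + 1)\<^sup>2 \<le> e / 4 \<and>
      \<beta> / (real k + 1)\<^sup>2 \<le> l * (1 / 96 * (l / (L1 + l)) * \<sigma>) \<and>
      L1 * x_spread / (real k + 1)\<^sup>2 \<le> 1 / 96 * l * \<sigma> \<and>
      L2 * x_spread / (real k + 1)\<^sup>2 \<le> 1 / 96 * l \<and>
      g_spread / (real k + 1)\<^sup>2 \<le> e\<^sup>2 \<and> H_spread / (real k + 1)\<^sup>2 \<le> e powr (3/2) \<and>
      x_spread / (real k + 1)\<^sup>2 \<le> e powr (3/2) \<and>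
      H_err / (real k + 1)\<^sup>2 \<le> (1 + L2) * e powr (3/2)"
    unfolding eventually_sequentially by blast
  have "burned_in f L1 L2 M r e K"
    unfolding burned_in_def Let_def
  proof (intro conjI allI impI)
    fix k assume k: "K \<le> k"
    note small = K[OF k]
    show "Delta_g r k \<le> e\<^sup>2" "Delta_H r k \<le> e powr (3/2)" "dispersion r k \<le> e powr (3/2)"
      "delbar r k \<le> (1 + L2) * e powr (3/2)"
      using small Delta_g_le[of k] Delta_H_le[of k] dispersion_le[of k] delbar_le[of k] by linarith+
    assume "e \<le> grad_norm f r k"
    then have large: "e \<le> norm (gradF (xbar r k))" by (simp add: grad_norm_eq)
    have g: "g_err / (real k + 1)\<^sup>2 \<le> e / 2"
      and b: "2 * sensitivity (sqrt (M * (e / 2))) * s_bound / (real k + 1)\<^sup>2 \<le> e / 4"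
      using small by (simp_all add: \<beta>_def l_def)
    note ref = reference_step[OF e g large b, folded l_def, folded \<beta>_def]
    show "invertible (A_ref M r k)" by (rule ref)
    let ?\<Lambda> = "lambar M r k"
    have \<sigma>: "\<sigma> \<le> norm (sbar r k)"
      using ref(3) pos by (simp add: \<sigma>_def field_simps)
    have "l / (L1 + l) \<le> ?\<Lambda> / (L1 + ?\<Lambda>)"
      using ref(4) pos mult_left_mono[OF ref(4), of L1] by (simp add: field_simps)
    then have rhs: "1 / 96 * (l / (L1 + l)) * \<sigma> \<le> 1 / 96 * (?\<Lambda> / (L1 + ?\<Lambda>)) * norm (sbar r k)"
      using \<sigma> pos ref(4) by (intro mult_mono) auto
    have "l * norm (sbar r k - s_ref M r k) \<le> l * (1 / 96 * (l / (L1 + l)) * \<sigma>)"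
      using ref(2) small by linarith
    then have "norm (sbar r k - s_ref M r k) \<le> 1 / 96 * (l / (L1 + l)) * \<sigma>"
      using pos(1) by (rule mult_left_le_imp_le)
    then show "norm (sbar r k - s_ref M r k)
        \<le> 1 / 12 / 8 * (?\<Lambda> / (L1 + ?\<Lambda>)) * norm (sbar r k)"
      using rhs by simp
    have "1 / 96 * l * \<sigma> \<le> 1 / 96 * ?\<Lambda> * norm (sbar r k)"
      using \<sigma> pos ref(4) by (intro mult_mono) auto
    moreover have "L1 * dispersion r k \<le> L1 * x_spread / (real k + 1)\<^sup>2"
      using mult_left_mono[OF dispersion_le[of k] \<open>0 \<le> L1\<close>] by simp
    ultimately have "L1 * dispersion r k \<le> 1 / 96 * ?\<Lambda> * norm (sbar r k)"
      using small by linarith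
    then show "L1 * dispersion r k \<le> 1 / 12 / 8 * ?\<Lambda> * norm (sbar r k)" by simp
    have "L2 * dispersion r k \<le> L2 * x_spread / (real k + 1)\<^sup>2"
      using mult_left_mono[OF dispersion_le[of k] L2_nonneg] by simp
    then have "L2 * dispersion r k \<le> 1 / 96 * ?\<Lambda>"
      using small ref(4) by linarith
    then show "L2 * dispersion r k \<le> 1 / 12 / 8 * ?\<Lambda>" by simp
  qed
  then show ?thesis by blast
qed

end

section \<open>Communication rounds\<close>

lemma log_rounds_le:
  assumes "p \<ge> 0" "c \<ge> 0" "0 < \<rho>" "\<rho> < 1" and K: "real K \<le> x"
  shows "log_rounds p c \<rho> K \<le> 3 * x * ((p * ln (x + 2) + c) / (- ln \<rho>) + 1)"
proof -
  have ln: "0 < - ln \<rho>" using assms by simp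
  define b where "b = (p * ln (x + 2) + c) / (- ln \<rho>) + 1"
  have sched: "real (log_schedule p c \<rho> k) \<le> b" if "k < K" for k
  proof -
    define y where "y = (p * ln (real k + 2) + c) / (- ln \<rho>)"
    have "0 \<le> y" unfolding y_def using assms ln by (intro divide_nonneg_pos) auto
    then have "real (log_schedule p c \<rho> k) \<le> y + 1"
      unfolding log_schedule_def y_def[symmetric] by linarith
    also have "y + 1 \<le> b"
      unfolding y_def b_def using assms ln that K
      by (intro add_right_mono divide_right_mono mult_left_mono) auto
    finally show ?thesis .
  qed
  have b: "0 \<le> b"
    unfolding b_def using assms ln K by (intro add_nonneg_nonneg divide_nonneg_pos mult_nonneg_nonneg) auto
  have "log_rounds p c \<rho> K = (\<Sum>k<K. 3 * real (log_schedule p c \<rho> k))"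
    by (simp add: log_rounds_def comm_rounds_def sum.distrib sum_distrib_left[symmetric])
  also have "\<dots> \<le> (\<Sum>k<K. 3 * b)"
    by (intro sum_mono mult_left_mono sched) auto
  also have "\<dots> = 3 * real K * b" by simp
  also have "\<dots> \<le> 3 * x * b" using K b by (intro mult_right_mono) auto
  finally show ?thesis by (simp only: b_def)
qed

text \<open>
  A Landau bound that is uniform over \<open>S\<close> follows from one in \<open>\<epsilon>\<close> alone, by majorising the left-hand
  side and minorising the right-hand side independently of the instance.
\<close>

lemma bigo_uniformI:
  fixes h w :: "'a \<times> real \<Rightarrow> real" and g v :: "real \<Rightarrow> real"
  assumes "g \<in> O[at_right 0](v)"
    and h: "\<And>s \<epsilon>. s \<in> S \<Longrightarrow> 0 < \<epsilon> \<Longrightarrow> \<epsilon> < 1 \<Longrightarrow> \<bar>h (s, \<epsilon>)\<bar> \<le> g \<epsilon>"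
    and w: "\<And>s \<epsilon>. s \<in> S \<Longrightarrow> 0 < \<epsilon> \<Longrightarrow> \<epsilon> < 1 \<Longrightarrow> \<bar>v \<epsilon>\<bar> \<le> w (s, \<epsilon>)"
  shows "h \<in> O[principal S \<times>\<^sub>F at_right 0](w)"
proof -
  obtain c where c: "0 < c" "\<forall>\<^sub>F \<epsilon> in at_right 0. norm (g \<epsilon>) \<le> c * norm (v \<epsilon>)"
    using assms(1) by (rule landau_o.bigE)
  have "\<forall>\<^sub>F \<epsilon> in at_right 0. 0 < \<epsilon> \<and> \<epsilon> < (1::real)"
    by (rule eventually_at_rightI[of 0 1]) auto
  with c(2) have "\<forall>\<^sub>F \<epsilon> in at_right 0. norm (g \<epsilon>) \<le> c * norm (v \<epsilon>) \<and> 0 < \<epsilon> \<and> \<epsilon> < 1"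
    by (rule eventually_conj)
  moreover have "\<forall>\<^sub>F s in principal S. s \<in> S" by (simp add: eventually_principal)
  moreover have "norm (h (s, \<epsilon>)) \<le> c * norm (w (s, \<epsilon>))"
    if "s \<in> S" "norm (g \<epsilon>) \<le> c * norm (v \<epsilon>) \<and> 0 < \<epsilon> \<and> \<epsilon> < 1" for s \<epsilon>
  proof -
    have "norm (h (s, \<epsilon>)) \<le> c * \<bar>v \<epsilon>\<bar>" using h[of s \<epsilon>] that by auto
    also have "\<dots> \<le> c * norm (w (s, \<epsilon>))"
      using w[of s \<epsilon>] that c(1) by (intro mult_left_mono) auto
    finally show ?thesis .
  qed
  ultimately have "\<forall>\<^sub>F z in principal S \<times>\<^sub>F at_right 0. norm (h z) \<le> c * norm (w z)"
    unfolding eventually_prod_filter by blast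
  then show ?thesis by (rule landau_o.bigI[OF c(1)])
qed

theorem theoremA16:
  fixes L1 L2 D M p c_mix \<rho> :: real
    and x0 g0 :: "'n::finite \<Rightarrow> real^'d::finite" and H0 :: "'n \<Rightarrow> real^'d^'d"
  assumes "D > 0" and "M > 0" and "M \<ge> L2" and "p \<ge> 3" and "c_mix \<ge> 0" and "0 < \<rho>" and "\<rho> < 1"
  shows "let S = instances L1 L2 D M p c_mix \<rho> x0 g0 H0;
             K = (\<lambda>f r \<epsilon>. first_hit f r \<epsilon>);
             K0 = (\<lambda>f r \<epsilon>. real (burn_in_index f L1 L2 M r \<epsilon>));
             rounds = log_rounds p c_mix \<rho>
         in
           (\<forall>(f, W, r)\<in>S. \<forall>\<epsilon>. 0 < \<epsilon> \<and> \<epsilon> \<le> 1 \<longrightarrow>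
              (\<exists>k. grad_norm f r k \<le> \<epsilon>) \<and> (\<exists>k. burned_in f L1 L2 M r \<epsilon> k)) \<and>
           (\<lambda>((f, W, r), \<epsilon>). rounds (K f r \<epsilon>))
             \<in> O[principal S \<times>\<^sub>F at_right 0](\<lambda>((f, W, r), \<epsilon>).
                 1 / (1 - \<rho>) * (K0 f r \<epsilon> + 1 / \<epsilon>) * ln (K0 f r \<epsilon> + 1 / \<epsilon>)) \<and>
           (\<lambda>((f, W, r), \<epsilon>). rounds (K f r \<epsilon>))
             \<in> O[principal S \<times>\<^sub>F at_right 0](\<lambda>((f, W, r), \<epsilon>).
                 1 / (1 - \<rho>) * (1 / \<epsilon>) * ln (1 / \<epsilon>)) \<and>
           (\<lambda>((f, W, r), \<epsilon>). rounds (K f r \<epsilon>))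
             \<in> O[principal S \<times>\<^sub>F at_right 0](\<lambda>((f, W, r), \<epsilon>).
                 1 / \<epsilon> * ln (1 / \<epsilon>))"
proof -
  let ?\<tau> = "log_schedule p c_mix \<rho>" and ?S = "instances L1 L2 D M p c_mix \<rho> x0 g0 H0"
  let ?v = "\<lambda>\<epsilon>::real. 1 / \<epsilon> * ln (1 / \<epsilon>)"
  \<comment> \<open>The maximum makes \<open>C\<close> positive even if there are no instances at all.\<close>
  define C where "C = max 1 (disgrem_instance.hit_const L1 L2 D M x0 g0 H0)"
  define g where "g \<epsilon> = 3 * (C / \<epsilon>) * ((p * ln (C / \<epsilon> + 2) + c_mix) / (- ln \<rho>) + 1)" for \<epsilon>
  have inst: "disgrem_instance f W r ?\<tau> ?\<tau> L1 L2 D M x0 g0 H0" if "(f, W, r) \<in> ?S" for f W r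
  proof -
    have "\<rho> ^ ?\<tau> k \<le> 1 / (real k + 2)\<^sup>2" for k
      by (rule log_schedule_decay) (use assms in auto)
    then show ?thesis
      using that assms unfolding instances_def by unfold_locales auto
  qed
  have hit: "\<exists>k. real k \<le> C / \<epsilon> \<and> grad_norm f r k \<le> \<epsilon>"
    if "(f, W, r) \<in> ?S" "0 < \<epsilon>" "\<epsilon> \<le> 1" for f W r \<epsilon>
  proof -
    have "disgrem_instance.hit_const L1 L2 D M x0 g0 H0 / \<epsilon> \<le> C / \<epsilon>"
      using that by (intro divide_right_mono) (auto simp: C_def)
    then show ?thesis
      using disgrem_instance.hit[OF inst[OF that(1)] that(2,3)] by (meson order_trans)
  qed
  have rounds: "\<bar>log_rounds p c_mix \<rho> (first_hit f r \<epsilon>)\<bar> \<le> g \<epsilon>"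
    if e: "(f, W, r) \<in> ?S" "0 < \<epsilon>" "\<epsilon> < 1" for f W r \<epsilon>
  proof -
    obtain k where k: "real k \<le> C / \<epsilon>" "grad_norm f r k \<le> \<epsilon>"
      using hit[OF e(1,2)] e(3) by auto
    have "first_hit f r \<epsilon> \<le> k"
      unfolding first_hit_def using k(2) by (rule Least_le)
    then have "real (first_hit f r \<epsilon>) \<le> C / \<epsilon>" using k(1) by linarith
    then have "log_rounds p c_mix \<rho> (first_hit f r \<epsilon>) \<le> g \<epsilon>"
      unfolding g_def using assms by (intro log_rounds_le) auto
    then show ?thesis by (simp add: log_rounds_def)
  qed
  have "C > 0" "p > 0" "- ln \<rho> > 0" using assms by (auto simp: C_def)
  then have g: "g \<in> O[at_right 0](?v)"
    unfolding g_def using assms(5) by real_asymp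
  have v: "0 \<le> ?v \<epsilon>" if "0 < \<epsilon>" "\<epsilon> < 1" for \<epsilon> :: real
    using that by simp
  have scale: "x \<le> 1 / (1 - \<rho>) * x" if "0 \<le> x" for x
    using that assms mult_right_mono[of 1 "1 / (1 - \<rho>)" x] by simp
  have mono: "?v \<epsilon> \<le> (real n + 1 / \<epsilon>) * ln (real n + 1 / \<epsilon>)" if "0 < \<epsilon>" "\<epsilon> < 1" for \<epsilon> :: real and n
  proof (rule mult_mono)
    have "0 < 1 / \<epsilon>" using that by simp
    then show "ln (1 / \<epsilon>) \<le> ln (real n + 1 / \<epsilon>)" by (subst ln_le_cancel_iff) (auto intro: add_nonneg_pos)
    show "0 \<le> ln (1 / \<epsilon>)" using that by simp
  qed (use that in auto)
  show ?thesis
    unfolding Let_def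
  proof (intro conjI)
    show "\<forall>(f, W, r)\<in>?S. \<forall>\<epsilon>. 0 < \<epsilon> \<and> \<epsilon> \<le> 1 \<longrightarrow>
        (\<exists>k. grad_norm f r k \<le> \<epsilon>) \<and> (\<exists>k. burned_in f L1 L2 M r \<epsilon> k)"
      using hit disgrem_instance.burned_in_exists[OF inst] by blast
    show "(\<lambda>((f, W, r), \<epsilon>). log_rounds p c_mix \<rho> (first_hit f r \<epsilon>))
        \<in> O[principal ?S \<times>\<^sub>F at_right 0](\<lambda>((f, W, r), \<epsilon>). 1 / (1 - \<rho>) * (real (burn_in_index f L1 L2 M r \<epsilon>) + 1 / \<epsilon>)
          * ln (real (burn_in_index f L1 L2 M r \<epsilon>) + 1 / \<epsilon>))"
    proof (rule bigo_uniformI[OF g], goal_cases)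
      case (1 s \<epsilon>)
      then show ?case using rounds by (cases s) simp
    next
      case (2 s \<epsilon>)
      obtain f W r where s: "s = (f, W, r)" by (cases s)
      let ?y = "(real (burn_in_index f L1 L2 M r \<epsilon>) + 1 / \<epsilon>) * ln (real (burn_in_index f L1 L2 M r \<epsilon>) + 1 / \<epsilon>)"
      have "\<bar>?v \<epsilon>\<bar> \<le> ?y" using v mono 2 by (simp only: abs_of_nonneg)
      also have "\<dots> \<le> 1 / (1 - \<rho>) * ?y"
        using v mono 2 by (intro scale) (meson order_trans)
      finally show ?case by (simp add: s mult.assoc)
    qed
    show "(\<lambda>((f, W, r), \<epsilon>). log_rounds p c_mix \<rho> (first_hit f r \<epsilon>))
        \<in> O[principal ?S \<times>\<^sub>F at_right 0](\<lambda>((f, W, r), \<epsilon>). 1 / (1 - \<rho>) * (1 / \<epsilon>) * ln (1 / \<epsilon>))"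
    proof (rule bigo_uniformI[OF g], goal_cases)
      case (1 s \<epsilon>)
      then show ?case using rounds by (cases s) simp
    next
      case (2 s \<epsilon>)
      then show ?case using v scale[OF v, of \<epsilon>] by (cases s) (simp only: abs_of_nonneg prod.case mult.assoc)
    qed
    show "(\<lambda>((f, W, r), \<epsilon>). log_rounds p c_mix \<rho> (first_hit f r \<epsilon>))
        \<in> O[principal ?S \<times>\<^sub>F at_right 0](\<lambda>((f, W, r), \<epsilon>). 1 / \<epsilon> * ln (1 / \<epsilon>))"
    proof (rule bigo_uniformI[OF g], goal_cases)
      case (1 s \<epsilon>)
      then show ?case using rounds by (cases s) simp
    next
      case (2 s \<epsilon>)
      then show ?case using v by (cases s) (simp only: abs_of_nonneg prod.case)
    qed
  qed
qed

end
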